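(* Let $G$ be a graph with $n$ vertices and let $d\ge 0$ be an integer. Then $\mathrm{mlt}(G)=d+1$ if and only if $d$ is the smallest dimension in which no generic $d$-dimensional framework $(G,p)$ supports a non-zero PSD equilibrium stress.
   Context: Let $G$ be a graph with vertex set $\{1,\dots,n\}$. Given data vectors $X_1,\dots,X_N\in\mathbb{R}^n$ with sample covariance $S=\frac1N\sum_k X_kX_k^T$, the maximum likelihood estimate (MLE) of the Gaussian graphical model of $G$ exists if the problem of minimizing $\operatorname{tr}(SK)-\log\det K$ over positive definite symmetric $n\times n$ matrices $K$ with $K_{ij}=0$ whenever $i\neq j$ and $ij$ is not an edge of $G$ attains its minimum. The maximum likelihood threshold $\mathrm{mlt}(G)$ is the smallest $N$ such that, when $X_1,\dots,X_N$ are i.i.d. samples from a probability distribution on $\mathbb{R}^n$ mutually absolutely continuous with respect to Lebesgue measure, the MLE exists almost surely. A $d$-dimensional framework $(G,p)$ is an assignment of points $p(1),\dots,p(n)\in\mathbb{R}^d$; it is generic if the $nd$ coordinates are algebraically independent over $\mathbb{Q}$. An equilibrium stress of $(G,p)$ is an assignment of real weights $\omega_{ij}$ to the edges with $\sum_{j\sim i}\omega_{ij}(p(j)-p(i))=0$ for every vertex $i$. Its stress matrix $\Omega$ is the symmetric $n\times n$ matrix with $\Omega_{ij}=\Omega_{ji}=-\omega_{ij}$ for edges $ij$, $\Omega_{ii}=\sum_j\omega_{ij}$, and all other entries $0$; the stress is PSD if $\Omega$ is positive semidefinite. *)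

theory Defs
  imports
    "HOL-Probability.Probability"
    "HOL-Library.Poly_Mapping"
    "HOL-Library.Extended_Nat"
begin

text \<open>A simple graph on the finite vertex type \<open>'n\<close> is given by its set of edges, each edge being
  a two-element set of vertices.\<close>

definition simple_graph :: "'n set set \<Rightarrow> bool" where
  "simple_graph E \<longleftrightarrow> (\<forall>e\<in>E. card e = 2)"

definition neighbours :: "'n set set \<Rightarrow> 'n \<Rightarrow> 'n set" where
  "neighbours E i = {j. {i, j} \<in> E}"

definition positive_definite :: "real ^ 'n ^ 'n \<Rightarrow> bool" where
  "positive_definite A \<longleftrightarrow> transpose A = A \<and> (\<forall>x. x \<noteq> 0 \<longrightarrow> x \<bullet> (A *v x) > 0)"

definition positive_semidefinite :: "real ^ 'n ^ 'n \<Rightarrow> bool" where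
  "positive_semidefinite A \<longleftrightarrow> transpose A = A \<and> (\<forall>x. x \<bullet> (A *v x) \<ge> 0)"

section \<open>Maximum likelihood threshold\<close>

text \<open>The samples are \<open>X 0, \<dots>, X (N - 1)\<close>.\<close>

definition sample_covariance :: "nat \<Rightarrow> (nat \<Rightarrow> real ^ 'n) \<Rightarrow> real ^ 'n ^ 'n" where
  "sample_covariance N X = (1 / real N) *\<^sub>R (\<Sum>k<N. (\<chi> i j. X k $ i * X k $ j))"

definition concentration_matrices :: "'n::finite set set \<Rightarrow> (real ^ 'n ^ 'n) set" where
  "concentration_matrices E =
     {K. positive_definite K \<and> (\<forall>i j. i \<noteq> j \<and> {i, j} \<notin> E \<longrightarrow> K $ i $ j = 0)}"

definition mle_objective :: "real ^ 'n ^ 'n \<Rightarrow> real ^ 'n ^ 'n \<Rightarrow> real" where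
  "mle_objective S K = trace (S ** K) - ln (det K)"

definition mle_exists :: "'n::finite set set \<Rightarrow> nat \<Rightarrow> (nat \<Rightarrow> real ^ 'n) \<Rightarrow> bool" where
  "mle_exists E N X \<longleftrightarrow>
     (\<exists>K \<in> concentration_matrices E. \<forall>K' \<in> concentration_matrices E.
        mle_objective (sample_covariance N X) K \<le> mle_objective (sample_covariance N X) K')"

definition mutually_abs_cont_prob :: "(real ^ 'n) measure \<Rightarrow> bool" where
  "mutually_abs_cont_prob M \<longleftrightarrow>
     prob_space M \<and> sets M = sets lborel \<and>
     absolutely_continuous lborel M \<and> absolutely_continuous M lborel"

text \<open>Independent samples with common distribution \<open>M\<close> are the coordinates of the product
  space. The threshold is valued in \<^typ>\<open>enat\<close> so that the equation \<open>mlt E = enat N\<close>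
  includes the assertion that some \<open>N\<close> with the required property exists.\<close>

definition mlt :: "'n::finite set set \<Rightarrow> enat" where
  "mlt E = Inf {enat N | N. N \<ge> 1 \<and>
     (\<forall>M :: (real ^ 'n) measure. mutually_abs_cont_prob M \<longrightarrow>
        (AE X in PiM {..<N} (\<lambda>_. M). mle_exists E N X))}"

section \<open>Frameworks and stresses\<close>

text \<open>A polynomial with rational coefficients in variables indexed by \<open>'i\<close> is a finitely
  supported map from exponent vectors to coefficients.\<close>

definition eval_rat_poly :: "(('i \<Rightarrow>\<^sub>0 nat) \<Rightarrow>\<^sub>0 rat) \<Rightarrow> ('i \<Rightarrow> real) \<Rightarrow> real" where
  "eval_rat_poly f x =
     (\<Sum>m \<in> Poly_Mapping.keys f. of_rat (Poly_Mapping.lookup f m) * (\<Prod>i \<in> Poly_Mapping.keys m. x i ^ Poly_Mapping.lookup m i))"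

definition algebraically_independent :: "'i set \<Rightarrow> ('i \<Rightarrow> real) \<Rightarrow> bool" where
  "algebraically_independent I x \<longleftrightarrow>
     (\<forall>f. (\<forall>m \<in> Poly_Mapping.keys f. Poly_Mapping.keys m \<subseteq> I) \<and> eval_rat_poly f x = 0 \<longrightarrow> f = 0)"

text \<open>The dimension \<open>d\<close> has to vary, so the point \<open>p i\<close> of \<open>\<real>\<^sup>d\<close> is given by
  its coordinates \<open>p i c\<close> with \<open>c < d\<close>; values at \<open>c \<ge> d\<close> are never used.\<close>

definition generic_framework :: "nat \<Rightarrow> ('n \<Rightarrow> nat \<Rightarrow> real) \<Rightarrow> bool" where
  "generic_framework d p \<longleftrightarrow>
     algebraically_independent (UNIV \<times> {..<d}) (\<lambda>(i, c). p i c)"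

definition equilibrium_stress ::
    "'n set set \<Rightarrow> nat \<Rightarrow> ('n \<Rightarrow> nat \<Rightarrow> real) \<Rightarrow> ('n set \<Rightarrow> real) \<Rightarrow> bool" where
  "equilibrium_stress E d p \<omega> \<longleftrightarrow>
     (\<forall>i. \<forall>c<d. (\<Sum>j \<in> neighbours E i. \<omega> {i, j} * (p j c - p i c)) = 0)"

text \<open>Only the values of \<open>\<omega>\<close> on \<open>E\<close> matter.\<close>

definition nonzero_stress :: "'n set set \<Rightarrow> ('n set \<Rightarrow> real) \<Rightarrow> bool" where
  "nonzero_stress E \<omega> \<longleftrightarrow> (\<exists>e \<in> E. \<omega> e \<noteq> 0)"

definition stress_matrix :: "'n set set \<Rightarrow> ('n set \<Rightarrow> real) \<Rightarrow> real ^ 'n ^ 'n" where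
  "stress_matrix E \<omega> =
     (\<chi> i j. if i = j then (\<Sum>k \<in> neighbours E i. \<omega> {i, k})
             else if {i, j} \<in> E then - \<omega> {i, j} else 0)"

definition supports_psd_stress ::
    "'n::finite set set \<Rightarrow> nat \<Rightarrow> ('n \<Rightarrow> nat \<Rightarrow> real) \<Rightarrow> bool" where
  "supports_psd_stress E d p \<longleftrightarrow>
     (\<exists>\<omega>. equilibrium_stress E d p \<omega> \<and> nonzero_stress E \<omega> \<and>
        positive_semidefinite (stress_matrix E \<omega>))"

definition no_generic_psd_stress :: "'n::finite set set \<Rightarrow> nat \<Rightarrow> bool" where
  "no_generic_psd_stress E d \<longleftrightarrow>
     \<not> (\<exists>p. generic_framework d p \<and> supports_psd_stress E d p)"

end

theory Submission
  imports Defs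
begin

text \<open>By convex duality the MLE exists iff no non-zero PSD matrix supported on the graph annihilates
  all samples. Dividing \<open>d + 1\<close> samples by the last one identifies such matrices with PSD
  stresses of a \<open>d\<close>-dimensional framework, which is generic for almost all samples. It remains to
  see that a PSD stress of a generic framework persists on a neighbourhood, a set of positive
  measure. For this, the rational polynomial functions of the framework have germs that are
  determined by their value at the generic point. This property survives adjoining, one by one,
  functions that take the stress coefficients as values; afterwards all equations and
  signs that hold at the point hold nearby.\<close>

section \<open>Semidefinite matrices and determinants\<close>

text \<open>The delicate direction leads from one generic framework to a set of positive measure.
  Genericity forbids only rational polynomial relations among the coordinates, whereas the stress
  coefficients may be algebraic over them or entirely independent of them, and an equation that
  holds at a single point says nothing about nearby points in general. Quantifier elimination for
  semialgebraic sets would settle this; here the given stress itself is extended to functions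
  instead. Semidefiniteness is a further obstacle: it is a closed condition, and a zero eigenvalue
  could turn negative under perturbation. The degenerate cases therefore have to be captured by
  equations as well, since those are known to persist. In the other direction the countably many
  rational polynomials can be treated one at a time. The equivalence is obtained for each pair
  \<open>N = d + 1\<close> and \<open>d\<close> separately, and so carries over to the smallest
  values.\<close>

definition outer :: "real ^ 'n \<Rightarrow> real ^ 'n \<Rightarrow> real ^ 'n ^ 'n" where
  "outer v w = (\<chi> i j. v $ i * w $ j)"

lemma outer_mult_vec: "outer v w *v x = (w \<bullet> x) *\<^sub>R v"
  by (simp add: outer_def matrix_vector_mult_def inner_vec_def vec_eq_iff sum_distrib_left mult_ac)

lemma transpose_outer: "transpose (outer v w) = outer w v"
  by (simp add: outer_def transpose_def vec_eq_iff mult.commute)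

text \<open>Only column \<open>k\<close> of the identity changes, into the image of
  \<open>axis k 1 + c *\<^sub>R w\<close>, so Cramer's rule applies.\<close>

lemma det_mat1_plus_outer_axis:
  fixes w :: "real ^ 'n"
  shows "det (mat 1 + outer w (c *\<^sub>R axis k 1)) = 1 + c * w $ k"
proof -
  have "mat 1 + outer w (c *\<^sub>R axis k 1) =
      (\<chi> i j. if j = k then ((mat 1 :: real^'n^'n) *v (axis k 1 + c *\<^sub>R w)) $ i else mat 1 $ i $ j)"
    unfolding matrix_vector_mul_lid by (auto simp: outer_def vec_eq_iff mat_def axis_def)
  then show ?thesis by (simp only: cramer_lemma) simp
qed

text \<open>An orthogonal change of basis turns \<open>v\<close> into a multiple of a coordinate
  vector and preserves both the determinant and the inner product, which reduces the claim to the
  previous case.\<close>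

lemma det_mat1_plus_outer:
  fixes v w :: "real ^ 'n"
  shows "det (mat 1 + outer w v) = 1 + w \<bullet> v"
proof (cases "v = 0")
  case True
  then have "outer w v = 0" by (simp add: outer_def vec_eq_iff)
  with True show ?thesis by simp
next
  case False
  fix k :: 'n
  have "norm (v /\<^sub>R norm v) = 1" using False by simp
  then obtain Q where Q: "orthogonal_matrix Q" "Q *v axis k 1 = v /\<^sub>R norm v"
    using orthogonal_matrix_exists_basis by metis
  have QQ: "transpose Q ** Q = mat 1" using Q(1) by (simp add: orthogonal_matrix)
  have v: "v = Q *v (norm v *\<^sub>R axis k 1)"
    using Q(2) False by (simp add: matrix_vector_mult_scaleR)
  define u where "u = norm v *\<^sub>R (axis k 1 :: real^'n)"
  have Qv: "transpose Q *v v = u"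
    by (subst v) (simp add: matrix_vector_mul_assoc QQ u_def)
  have "transpose Q ** (mat 1 + outer w v) ** Q = mat 1 + outer (transpose Q *v w) u"
  proof (subst matrix_eq, intro allI)
    fix x
    have "v \<bullet> (Q *v x) = u \<bullet> x"
      using Qv by (simp add: dot_lmul_matrix[symmetric])
    moreover have "(Q *v x) v* Q = x"
      by (metis QQ matrix_vector_mul_assoc matrix_vector_mul_lid transpose_matrix_vector)
    moreover have "(c *\<^sub>R w) v* Q = c *\<^sub>R (w v* Q)" for c
      by (metis matrix_vector_mult_scaleR transpose_matrix_vector)
    ultimately show "(transpose Q ** (mat 1 + outer w v) ** Q) *v x
        = (mat 1 + outer (transpose Q *v w) u) *v x"
      by (simp add: matrix_vector_mul_assoc[symmetric] matrix_vector_mult_add_rdistrib outer_mult_vec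
          vector_matrix_left_distrib matrix_vector_right_distrib)
  qed
  moreover have "det (transpose Q ** (mat 1 + outer w v) ** Q) = det (mat 1 + outer w v)"
    using arg_cong[OF QQ, of det] by (simp add: det_mul algebra_simps)
  moreover have "det (mat 1 + outer (transpose Q *v w) u) = 1 + norm v * (transpose Q *v w) $ k"
    unfolding u_def by (rule det_mat1_plus_outer_axis)
  moreover have "norm v * (transpose Q *v w) $ k = (transpose Q *v w) \<bullet> u"
    by (simp add: u_def inner_axis)
  moreover have "(transpose Q *v w) \<bullet> u = w \<bullet> (Q *v u)"
    by (simp add: dot_lmul_matrix)
  moreover have "Q *v u = v" using v u_def by metis
  ultimately show ?thesis by metis
qed

section \<open>Positive semidefinite forms and monotonicity of the determinant\<close>

lemma quadratic_nonneg_discriminant: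
  fixes a b c :: real
  assumes "\<And>t. 0 \<le> a + 2 * b * t + c * t\<^sup>2"
  shows "b\<^sup>2 \<le> a * c"
proof -
  have c: "c \<ge> 0"
  proof (rule ccontr)
    assume "\<not> c \<ge> 0"
    then have "c < 0" by simp
    have 1: "0 \<le> a + 2 * b * t + c * t\<^sup>2" "0 \<le> a - 2 * b * t + c * t\<^sup>2" for t
      using assms[of t] assms[of "-t"] by simp_all
    \<comment> \<open>Averaging the values at \<open>t\<close> and \<open>-t\<close> removes the
      linear term. The choice of \<open>t\<close> below makes \<open>c\<close> times its square
      equal to \<open>-(a + 1)\<close>, which leaves \<open>-1\<close>.\<close>
    have "0 \<le> a + c * t\<^sup>2" for t using 1[of t] by linarith
    from this[of "sqrt ((a + 1) / - c)"] have "0 \<le> a + c * ((a + 1) / - c)"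
      using \<open>c < 0\<close> 1[of 0] by (simp add: divide_nonneg_neg)
    then show False using \<open>c < 0\<close> by (simp add: field_simps)
  qed
  show ?thesis
  proof (cases "c = 0")
    case True
    have "b = 0"
    proof (rule ccontr)
      assume "b \<noteq> 0"
      \<comment> \<open>At this \<open>t\<close> the linear function takes the value
        \<open>-1\<close>.\<close>
      then show False using assms[of "- (a + 1) / (2 * b)"] True by simp
    qed
    with True show ?thesis by simp
  next
    case False
    with c have "c > 0" by simp
    then show ?thesis using assms[of "- b / c"] by (simp add: field_simps power2_eq_square)
  qed
qed

lemma symmetric_inner: "transpose K = K \<Longrightarrow> x \<bullet> (K *v y) = y \<bullet> (K *v (x :: real^'n))"
  by (metis dot_lmul_matrix inner_commute transpose_matrix_vector)

lemma psd_Cauchy_Schwarz: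
  assumes "positive_semidefinite K"
  shows "(y \<bullet> (K *v x))\<^sup>2 \<le> (x \<bullet> (K *v x)) * (y \<bullet> (K *v y))"
proof (rule quadratic_nonneg_discriminant)
  fix t :: real
  have "0 \<le> (x + t *\<^sub>R y) \<bullet> (K *v (x + t *\<^sub>R y))"
    using assms by (simp add: positive_semidefinite_def)
  also have "\<dots> = x \<bullet> (K *v x) + 2 * (y \<bullet> (K *v x)) * t + y \<bullet> (K *v y) * t\<^sup>2"
    using symmetric_inner[of K x y] assms
    by (simp add: positive_semidefinite_def matrix_vector_right_distrib matrix_vector_mult_scaleR
        algebra_simps power2_eq_square)
  finally show "0 \<le> x \<bullet> (K *v x) + 2 * (y \<bullet> (K *v x)) * t + y \<bullet> (K *v y) * t\<^sup>2" .
qed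

text \<open>Cauchy-Schwarz with \<open>y = K *v x\<close>. This converts a vanishing trace term into
  the linear equations \<open>K *v X k = 0\<close>.\<close>

lemma psd_kernel:
  assumes "positive_semidefinite K" "x \<bullet> (K *v x) = 0"
  shows "K *v x = 0"
proof -
  have "((K *v x) \<bullet> (K *v x))\<^sup>2 \<le> 0"
    using psd_Cauchy_Schwarz[OF assms(1), of "K *v x" x] assms(2) by simp
  then show ?thesis by simp
qed

lemma psd_diag_zero:
  assumes "positive_semidefinite K" "\<And>i. K $ i $ i = 0"
  shows "K = 0"
proof -
  have "K *v axis i 1 = 0" for i
    using psd_kernel[OF assms(1), of "axis i 1"] assms(2)[of i]
    by (simp add: matrix_vector_mult_basis column_def inner_axis' )
  then show ?thesis
    by (simp add: matrix_vector_mult_basis column_def vec_eq_iff)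
qed

lemma positive_definite_imp_psd: "positive_definite A \<Longrightarrow> positive_semidefinite A"
  unfolding positive_definite_def positive_semidefinite_def
  by (metis inner_zero_left less_eq_real_def)

lemma positive_definite_add:
  assumes "positive_definite A" "positive_semidefinite K"
  shows "positive_definite (A + K)"
  unfolding positive_definite_def
proof (intro conjI allI impI)
  show "transpose (A + K) = A + K"
    using assms by (simp add: positive_definite_def positive_semidefinite_def transpose_def vec_eq_iff)
  show "0 < x \<bullet> ((A + K) *v x)" if "x \<noteq> 0" for x
    using assms that by (simp add: positive_definite_def positive_semidefinite_def
        matrix_vector_mult_add_rdistrib inner_add_right add_pos_nonneg)
qed

lemma psd_outer: "positive_semidefinite (outer v v)"
  by (simp add: positive_semidefinite_def transpose_outer outer_mult_vec inner_commute)

lemma psd_scaleR: "0 \<le> c \<Longrightarrow> positive_semidefinite K \<Longrightarrow> positive_semidefinite (c *\<^sub>R K)"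
  by (auto simp: positive_semidefinite_def transpose_def vec_eq_iff scaleR_matrix_vector_assoc[symmetric])

lemma positive_definite_invertible:
  fixes A :: "real ^ 'n ^ 'n"
  assumes "positive_definite A"
  shows "invertible A"
proof -
  have "x = 0" if "A *v x = 0" for x
    using that assms unfolding positive_definite_def by (metis inner_zero_right less_irrefl)
  then show ?thesis
    by (metis invertible_left_inverse matrix_left_invertible_ker)
qed

lemma psd_invertible:
  fixes K :: "real ^ 'n ^ 'n"
  assumes "positive_semidefinite K" "det K \<noteq> 0"
  shows "positive_definite K"
  unfolding positive_definite_def
proof (intro conjI allI impI)
  show "transpose K = K" using assms by (simp add: positive_semidefinite_def)
  fix x :: "real ^ 'n" assume "x \<noteq> 0"
  have "x \<bullet> (K *v x) \<noteq> 0"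
  proof
    assume "x \<bullet> (K *v x) = 0"
    then have "K *v x = 0" by (rule psd_kernel[OF assms(1)])
    with \<open>x \<noteq> 0\<close> assms(2) show False
      by (metis invertible_det_nz invertible_left_inverse matrix_left_invertible_ker)
  qed
  then show "0 < x \<bullet> (K *v x)"
    using assms(1) by (simp add: positive_semidefinite_def less_le)
qed

lemma positive_definite_mat1: "positive_definite (mat 1)"
  by (simp add: positive_definite_def transpose_mat)

lemma continuous_on_det [continuous_intros]:
  fixes f :: "'a::topological_space \<Rightarrow> real ^ 'n ^ 'n"
  assumes "continuous_on S f"
  shows "continuous_on S (\<lambda>x. det (f x))"
  unfolding det_def by (intro continuous_intros assms)

text \<open>The segment from the identity to \<open>A\<close> consists of positive definite, hence
  invertible matrices, so the determinant cannot change sign along it.\<close>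

lemma positive_definite_det_pos:
  fixes A :: "real ^ 'n ^ 'n"
  assumes "positive_definite A"
  shows "det A > 0"
proof (rule ccontr)
  assume "\<not> det A > 0"
  define B where "B t = (1 - t) *\<^sub>R (mat 1 :: real^'n^'n) + t *\<^sub>R A" for t :: real
  have pd: "positive_definite (B t)" if "0 \<le> t" "t \<le> 1" for t
  proof (cases "t = 1")
    case True then show ?thesis using assms by (simp add: B_def)
  next
    case False
    have "positive_definite ((1 - t) *\<^sub>R (mat 1 :: real^'n^'n))"
      using False that by (auto simp: positive_definite_def transpose_def vec_eq_iff mat_def
          scaleR_matrix_vector_assoc[symmetric] matrix_vector_mul_lid[unfolded mat_def])
    then show ?thesis unfolding B_def
      by (intro positive_definite_add psd_scaleR positive_definite_imp_psd assms that)
  qed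
  have "continuous_on {0..1} (\<lambda>t. det (B t))"
    unfolding B_def by (intro continuous_intros)
  moreover have "det (B 0) = 1" "det (B 1) = det A" by (simp_all add: B_def)
  ultimately obtain t where "0 \<le> t" "t \<le> 1" "det (B t) = 0"
    using IVT2'[of "\<lambda>t. det (B t)" 1 0 0] \<open>\<not> det A > 0\<close> by auto
  with pd[of t] positive_definite_invertible show False
    by (metis invertible_det_nz)
qed

text \<open>With \<open>w\<close> the solution of \<open>A *v w = v\<close>, the factorization
  \<open>A ** (mat 1 + outer w v)\<close> shows that the determinant is multiplied by
  \<open>1 + w \<bullet> v\<close>, and \<open>w \<bullet> v = w \<bullet> (A *v w)\<close> is
  positive.\<close>

lemma det_add_outer:
  fixes A :: "real ^ 'n ^ 'n"
  assumes "positive_definite A" "v \<noteq> 0"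
  shows "det A < det (A + outer v v)"
proof -
  obtain B where B: "A ** B = mat 1"
    using positive_definite_invertible[OF assms(1)] by (auto simp: invertible_def)
  define w where "w = B *v v"
  have Aw: "A *v w = v" by (simp add: w_def matrix_vector_mul_assoc B)
  have "A + outer v v = A ** (mat 1 + outer w v)"
    by (subst matrix_eq) (simp add: matrix_vector_mul_assoc[symmetric] matrix_vector_mult_add_rdistrib
        outer_mult_vec matrix_vector_right_distrib matrix_vector_mult_scaleR Aw)
  then have "det (A + outer v v) = det A * (1 + w \<bullet> v)"
    by (simp add: det_mul det_mat1_plus_outer)
  moreover have "w \<bullet> v > 0"
    using assms Aw by (metis matrix_vector_mult_0_right positive_definite_def)
  ultimately show ?thesis using positive_definite_det_pos[OF assms(1)] by simp
qed

text \<open>Splitting off \<open>v v\<^sup>T\<close> with \<open>v = K e\<^sub>i / sqrt K\<^sub>i\<^sub>i\<close> keeps the matrix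
  positive semidefinite by Cauchy-Schwarz and creates a new zero on the diagonal.\<close>

lemma det_add_psd:
  fixes A K :: "real ^ 'n ^ 'n"
  assumes "positive_definite A" "positive_semidefinite K" "K \<noteq> 0"
  shows "det A < det (A + K)"
  using assms
proof (induction "card {i. K $ i $ i \<noteq> 0}" arbitrary: A K rule: less_induct)
  case less
  obtain i where "K $ i $ i \<noteq> 0" using psd_diag_zero less.prems by blast
  have diag: "axis j 1 \<bullet> (L *v axis j 1) = L $ j $ j" for j and L :: "real ^ 'n ^ 'n"
    by (simp add: matrix_vector_mult_basis column_def inner_axis')
  have diag_ge: "L $ j $ j \<ge> 0" if "positive_semidefinite L" for j and L :: "real ^ 'n ^ 'n"
    using that diag[of j L] by (metis positive_semidefinite_def)
  have Kii: "K $ i $ i > 0" using \<open>K $ i $ i \<noteq> 0\<close> diag_ge[OF less.prems(2), of i] by simp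
  define v where "v = (1 / sqrt (K $ i $ i)) *\<^sub>R (K *v axis i 1)"
  have vj: "v $ j = K $ j $ i / sqrt (K $ i $ i)" for j
    by (simp add: v_def matrix_vector_mult_basis column_def)
  define K' where "K' = K - outer v v"
  have v0: "v \<noteq> 0" using vj[of i] Kii by auto
  have psd': "positive_semidefinite K'"
    unfolding positive_semidefinite_def
  proof (intro conjI allI)
    show "transpose K' = K'" using less.prems(2)
      by (simp add: K'_def positive_semidefinite_def transpose_def outer_def vec_eq_iff mult.commute)
    fix x
    have "(x \<bullet> (K *v axis i 1))\<^sup>2 \<le> K $ i $ i * (x \<bullet> (K *v x))"
      using psd_Cauchy_Schwarz[OF less.prems(2), of x "axis i 1"] by (simp add: diag)
    then have "(x \<bullet> (K *v axis i 1))\<^sup>2 / K $ i $ i \<le> x \<bullet> (K *v x)"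
      using Kii by (simp add: field_simps)
    moreover have "x \<bullet> (K' *v x) = x \<bullet> (K *v x) - (x \<bullet> v)\<^sup>2"
      by (simp add: K'_def matrix_vector_mult_diff_rdistrib outer_mult_vec inner_diff_right
          power2_eq_square inner_commute)
    moreover have "(x \<bullet> v)\<^sup>2 = (x \<bullet> (K *v axis i 1))\<^sup>2 / K $ i $ i"
      using Kii by (simp add: v_def power_divide)
    ultimately show "0 \<le> x \<bullet> (K' *v x)" by simp
  qed
  have K'j: "K' $ j $ j = K $ j $ j - (v $ j)\<^sup>2" for j
    by (simp add: K'_def outer_def power2_eq_square)
  have "K' $ i $ i = 0" using Kii by (simp add: K'j vj power_divide power2_eq_square)
  \<comment> \<open>Old zeros on the diagonal survive, because the diagonal of \<open>K'\<close> is
    non-negative and at most that of \<open>K\<close>.\<close>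
  moreover have "K' $ j $ j = 0" if "K $ j $ j = 0" for j
    using diag_ge[OF psd', of j] K'j[of j] that by simp
  ultimately have "{j. K' $ j $ j \<noteq> 0} \<subset> {j. K $ j $ j \<noteq> 0}"
    using \<open>K $ i $ i \<noteq> 0\<close> by blast
  then have card: "card {j. K' $ j $ j \<noteq> 0} < card {j. K $ j $ j \<noteq> 0}"
    by (intro psubset_card_mono) auto
  have eq: "A + K = (A + outer v v) + K'" by (simp add: K'_def)
  have "det A < det (A + outer v v)" by (rule det_add_outer[OF less.prems(1) v0])
  also have "\<dots> \<le> det (A + outer v v + K')"
    using less.hyps[OF card positive_definite_add[OF less.prems(1) psd_outer] psd', of v]
    by (cases "K' = 0") auto
  finally show ?case by (simp only: eq)
qed

section \<open>Existence of the MLE\<close>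

text \<open>Such a \<open>K\<close> is a direction in which the objective decreases without end.
  Unlike a stress matrix it need not annihilate the constant vector; a diagonal rescaling will
  restore this.\<close>

definition annihilated_by_psd :: "'n::finite set set \<Rightarrow> nat \<Rightarrow> (nat \<Rightarrow> real ^ 'n) \<Rightarrow> bool" where
  "annihilated_by_psd E N X \<longleftrightarrow> (\<exists>K. K \<noteq> 0 \<and> positive_semidefinite K \<and>
     (\<forall>i j. i \<noteq> j \<and> {i, j} \<notin> E \<longrightarrow> K $ i $ j = 0) \<and> (\<forall>k<N. K *v X k = 0))"

lemma trace_sample_covariance:
  assumes "transpose K = K"
  shows "trace (sample_covariance N X ** K) = (1 / real N) * (\<Sum>k<N. X k \<bullet> (K *v X k))"
proof -
  have sym: "K $ i $ j = K $ j $ i" for i j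
    using assms by (metis transpose_def vec_lambda_beta)
  have "(\<Sum>k<N. X k \<bullet> (K *v X k)) = (\<Sum>k<N. \<Sum>i\<in>UNIV. \<Sum>j\<in>UNIV. X k $ i * X k $ j * K $ j $ i)"
    by (simp add: inner_vec_def matrix_vector_mult_def sum_distrib_left mult_ac sym)
  also have "\<dots> = (\<Sum>i\<in>UNIV. \<Sum>j\<in>UNIV. (\<Sum>k<N. X k $ i * X k $ j) * K $ j $ i)"
    unfolding sum_distrib_right
    by (subst sum.swap, rule sum.cong[OF refl], subst sum.swap, rule refl)
  finally show ?thesis
    by (simp add: trace_def matrix_matrix_mult_def sample_covariance_def flip: sum_divide_distrib)
qed

text \<open>A crude bound from the Leibniz formula. It suffices that the logarithm of the
  determinant grows at most logarithmically in the norm.\<close>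

lemma abs_det_le:
  fixes A :: "real ^ 'n ^ 'n"
  shows "\<bar>det A\<bar> \<le> fact CARD('n) * norm A ^ CARD('n)"
proof -
  have "\<bar>A $ i $ j\<bar> \<le> norm A" for i j
    by (rule order_trans[OF component_le_norm_cart Finite_Cartesian_Product.norm_nth_le])
  then have "\<bar>of_int (sign p) * (\<Prod>i\<in>UNIV. A $ i $ p i)\<bar> \<le> norm A ^ CARD('n)" for p :: "'n \<Rightarrow> 'n"
    using prod_mono[of UNIV "\<lambda>i. \<bar>A $ i $ p i\<bar>" "\<lambda>_. norm A"]
    by (auto simp: abs_mult abs_prod sign_def)
  then have "\<bar>det A\<bar> \<le> (\<Sum>p | p permutes (UNIV :: 'n set). norm A ^ CARD('n))"
    unfolding det_def by (intro order_trans[OF sum_abs] sum_mono) auto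
  also have "\<dots> = fact CARD('n) * norm A ^ CARD('n)"
    by (simp add: card_permutations[OF refl])
  finally show ?thesis .
qed

text \<open>Positive definite matrices do not form a closed set, so minimization takes place in this
  larger cone; definiteness of the minimizer is recovered from its determinant.\<close>

lemma closed_psd_pattern:
  "closed {K :: real ^ 'n ^ 'n. positive_semidefinite K \<and> (\<forall>i j. i \<noteq> j \<and> {i, j} \<notin> E \<longrightarrow> K $ i $ j = 0)}"
proof -
  have eq: "{K :: real ^ 'n ^ 'n. positive_semidefinite K \<and> (\<forall>i j. i \<noteq> j \<and> {i, j} \<notin> E \<longrightarrow> K $ i $ j = 0)}
     = (\<Inter>i. \<Inter>j. {K. K $ i $ j = K $ j $ i}) \<inter> (\<Inter>x. {K. 0 \<le> x \<bullet> (K *v x)}) \<inter>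
       (\<Inter>i. \<Inter>j. {K. i \<noteq> j \<and> {i, j} \<notin> E \<longrightarrow> K $ i $ j = 0})"
    by (auto simp: positive_semidefinite_def transpose_def vec_eq_iff)
  show ?thesis unfolding eq matrix_vector_mult_def inner_vec_def
    by (intro closed_Int closed_INT ballI closed_Collect_eq closed_Collect_le closed_Collect_imp
        open_Collect_const continuous_intros)
qed

text \<open>Adding \<open>K\<close> to a supposed minimizer leaves the trace term unchanged and
  strictly raises the determinant.\<close>

lemma mle_not_exists:
  assumes "annihilated_by_psd E N X"
  shows "\<not> mle_exists E N X"
proof
  assume "mle_exists E N X"
  then obtain A where A: "A \<in> concentration_matrices E"
    and min: "\<And>K. K \<in> concentration_matrices E \<Longrightarrow>
      mle_objective (sample_covariance N X) A \<le> mle_objective (sample_covariance N X) K"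
    by (auto simp: mle_exists_def)
  from assms obtain K where K: "K \<noteq> 0" "positive_semidefinite K"
    "\<And>i j. i \<noteq> j \<and> {i, j} \<notin> E \<Longrightarrow> K $ i $ j = 0" "\<And>k. k < N \<Longrightarrow> K *v X k = 0"
    unfolding annihilated_by_psd_def by blast
  have pd: "positive_definite A" "positive_definite (A + K)"
    using A positive_definite_add[OF _ K(2)] by (auto simp: concentration_matrices_def)
  have "A + K \<in> concentration_matrices E"
    using A K(3) pd by (auto simp: concentration_matrices_def)
  moreover have "trace (sample_covariance N X ** (A + K)) = trace (sample_covariance N X ** A)"
    using pd K(4) by (simp add: trace_sample_covariance positive_definite_def matrix_vector_mult_add_rdistrib)
  moreover have "det A < det (A + K)" "0 < det A"
    using det_add_psd[OF pd(1) K(2,1)] positive_definite_det_pos[OF pd(1)] .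
  ultimately show False using min[of "A + K"] by (auto simp: mle_objective_def)
qed

text \<open>The trace term dominates a positive multiple of the norm on the closed cone of admissible
  semidefinite matrices, so the objective is coercive there.\<close>

lemma mle_exists_if_not_annihilated:
  fixes E :: "'n::finite set set"
  assumes "0 < N" "\<not> annihilated_by_psd E N X"
  shows "mle_exists E N X"
proof -
  define n where "n = CARD('n)"
  define C where "C = {K :: real ^ 'n ^ 'n. positive_semidefinite K \<and>
    (\<forall>i j. i \<noteq> j \<and> {i, j} \<notin> E \<longrightarrow> K $ i $ j = 0)}"
  define T where "T K = trace (sample_covariance N X ** K)" for K
  define f where "f K = mle_objective (sample_covariance N X) K" for K
  have f: "f K = T K - ln (det K)" for K by (simp add: f_def T_def mle_objective_def)
  have closedC: "closed C" unfolding C_def by (rule closed_psd_pattern)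
  have contT: "continuous_on S T" for S
    unfolding T_def trace_def matrix_matrix_mult_def by (simp, intro continuous_intros)
  have T: "T K = (1 / real N) * (\<Sum>k<N. X k \<bullet> (K *v X k))" if "K \<in> C" for K
    using that by (simp add: T_def C_def positive_semidefinite_def trace_sample_covariance)
  have T_nonneg: "T K \<ge> 0" if "K \<in> C" for K
    unfolding T[OF that] using that
    by (intro mult_nonneg_nonneg sum_nonneg) (auto simp: C_def positive_semidefinite_def)
  have T_pos: "T K > 0" if "K \<in> C" "K \<noteq> 0" for K
  proof (rule ccontr)
    assume "\<not> T K > 0"
    with T_nonneg[OF that(1)] T[OF that(1)] assms(1) have "(\<Sum>k<N. X k \<bullet> (K *v X k)) = 0" by simp
    then have "X k \<bullet> (K *v X k) = 0" if "k < N" for k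
      using that \<open>K \<in> C\<close> by (subst (asm) sum_nonneg_eq_0_iff) (auto simp: C_def positive_semidefinite_def)
    then have "annihilated_by_psd E N X" unfolding annihilated_by_psd_def
      using that by (intro exI[of _ K]) (auto simp: C_def intro: psd_kernel)
    with assms(2) show False by simp
  qed
  have T_scale: "T (c *\<^sub>R K) = c * T K" for c K
    by (simp add: T_def trace_def matrix_matrix_mult_def sum_distrib_left mult_ac)
  have mat1: "mat 1 \<in> C"
    using positive_definite_imp_psd[OF positive_definite_mat1] by (auto simp: C_def) (simp add: mat_def)
  \<comment> \<open>The constant is the minimum of \<open>T\<close> on the unit sphere of the cone,
    positive by \<open>T_pos\<close>; homogeneity spreads the bound over the cone.\<close>
  obtain c where c: "c > 0" "\<And>K. K \<in> C \<Longrightarrow> c * norm K \<le> T K"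
  proof -
    have compact: "compact (C \<inter> sphere 0 1)" using closedC by (simp add: closed_Int_compact)
    have unit: "K /\<^sub>R norm K \<in> C \<inter> sphere 0 1" if "K \<in> C" "K \<noteq> 0" for K
      using that psd_scaleR[of "inverse (norm K)" K] by (simp add: C_def)
    have "mat 1 \<noteq> (0 :: real ^ 'n ^ 'n)" by (simp add: mat_def vec_eq_iff)
    then have "C \<inter> sphere 0 1 \<noteq> {}" using unit[OF mat1] by blast
    from continuous_attains_inf[OF compact this contT] obtain M where
      M: "M \<in> C \<inter> sphere 0 1" "\<And>K. K \<in> C \<inter> sphere 0 1 \<Longrightarrow> T M \<le> T K" by blast
    have "M \<noteq> 0" using M(1) by auto
    show ?thesis
    proof (rule that[of "T M"])
      show "T M > 0" using T_pos M(1) \<open>M \<noteq> 0\<close> by simp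
      fix K assume "K \<in> C"
      show "T M * norm K \<le> T K"
      proof (cases "K = 0")
        case False
        then have "T M \<le> T K / norm K"
          using M(2)[OF unit[OF \<open>K \<in> C\<close> False]] by (simp add: T_scale field_simps)
        with False show ?thesis by (simp add: field_simps)
      qed (simp add: T_def trace_def matrix_matrix_mult_def)
    qed
  qed
  define b where "b = f (mat 1)"
  \<comment> \<open>A lower bound for the objective at norm \<open>r\<close>: the linear growth of
    the trace term minus the logarithm of the bound on the determinant. The identity matrix supplies
    the level \<open>b\<close> to be beaten.\<close>
  define g where "g r = c * r - (ln (fact n) + real n * ln r)" for r :: real
  have "filterlim g at_top at_top"
    unfolding g_def using c(1) by real_asymp
  then obtain R where R: "\<And>r. r \<ge> R \<Longrightarrow> g r > b"
    by (metis eventually_at_top_linorder filterlim_at_top_dense)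
  have det_le: "ln (det K) \<le> ln (fact n) + real n * ln (norm K)" if "det K > 0" for K :: "real ^ 'n ^ 'n"
  proof -
    have "det (0 :: real ^ 'n ^ 'n) = 0" by (rule det_zero_row) (simp add: row_def vec_eq_iff)
    then have "K \<noteq> 0" using that by auto
    then have "ln (det K) \<le> ln (fact n * norm K ^ n)"
      using abs_det_le[of K] that by (intro ln_mono) (auto simp: n_def)
    also have "\<dots> = ln (fact n) + real n * ln (norm K)"
      using \<open>K \<noteq> 0\<close> by (simp add: ln_mult ln_realpow)
    finally show ?thesis .
  qed
  \<comment> \<open>\<open>B\<close> contains every concentration matrix with objective at most
    \<open>b\<close>: as \<open>T\<close> is non-negative, such a matrix satisfies
    \<open>ln (det K) \<ge> - b\<close>. The lower bound on the determinant also keeps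
    \<open>B\<close> away from singular matrices, so the objective is continuous on it.\<close>
  define B where "B = (C \<inter> {K. exp (- b) \<le> det K}) \<inter> cball 0 R"
  have conc: "K \<in> C" "det K > 0" if "K \<in> concentration_matrices E" for K
    using that by (auto simp: C_def concentration_matrices_def positive_definite_imp_psd positive_definite_det_pos)
  have inB: "K \<in> B" if "K \<in> concentration_matrices E" "f K \<le> b" for K
  proof -
    note K = conc[OF that(1)]
    have "- b \<le> ln (det K)" using T_nonneg[OF K(1)] that(2) by (simp add: f)
    then have "exp (- b) \<le> det K" using K(2) by (metis exp_le_cancel_iff exp_ln)
    moreover have "g (norm K) \<le> b"
      using det_le[OF K(2)] c(2)[OF K(1)] that(2) by (simp add: f g_def)
    then have "norm K \<le> R" using R[of "norm K"] by linarith
    ultimately show ?thesis using K(1) by (simp add: B_def)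
  qed
  have "closed {K :: real ^ 'n ^ 'n. exp (- b) \<le> det K}"
    by (intro closed_Collect_le continuous_intros)
  then have "compact B" unfolding B_def using closedC by (intro closed_Int_compact closed_Int) auto
  have one: "mat 1 \<in> concentration_matrices E"
    using positive_definite_mat1 by (auto simp: concentration_matrices_def) (simp add: mat_def)
  have "mat 1 \<in> B" using inB[OF one] by (simp add: b_def)
  have det_B: "det K > 0" if "K \<in> B" for K
    using that by (auto simp: B_def intro: less_le_trans[OF exp_gt_zero])
  have "continuous_on B f" unfolding f
    using det_B by (intro continuous_intros contT) (auto simp: less_imp_neq[THEN not_sym] dest!: det_B)
  from continuous_attains_inf[OF \<open>compact B\<close> _ this] \<open>mat 1 \<in> B\<close> obtain M where
    M: "M \<in> B" "\<And>K. K \<in> B \<Longrightarrow> f M \<le> f K" by blast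
  have "M \<in> concentration_matrices E"
    using M(1) det_B[OF M(1)] by (auto simp: B_def C_def concentration_matrices_def intro!: psd_invertible)
  moreover have "f M \<le> f K" if "K \<in> concentration_matrices E" for K
    using M(2)[OF \<open>mat 1 \<in> B\<close>] M(2)[OF inB[OF that]] by (cases "f K \<le> b") (auto simp: b_def)
  ultimately show ?thesis unfolding mle_exists_def f_def by blast
qed

lemma mle_exists_iff:
  "0 < N \<Longrightarrow> mle_exists E N X \<longleftrightarrow> \<not> annihilated_by_psd E N X"
  using mle_not_exists mle_exists_if_not_annihilated by blast

section \<open>Stresses and annihilating matrices\<close>

lemma stress_matrix_mult_vec:
  fixes E :: "'n::finite set set"
  assumes "simple_graph E"
  shows "(stress_matrix E \<omega> *v x) $ i = (\<Sum>j\<in>neighbours E i. \<omega> {i, j} * (x $ i - x $ j))"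
proof -
  have "{i, i} \<notin> E" using assms by (auto simp: simple_graph_def)
  then have nb: "neighbours E i \<subseteq> UNIV - {i}" by (auto simp: neighbours_def)
  have "(stress_matrix E \<omega> *v x) $ i
      = stress_matrix E \<omega> $ i $ i * x $ i + (\<Sum>j\<in>UNIV - {i}. stress_matrix E \<omega> $ i $ j * x $ j)"
    by (simp add: matrix_vector_mult_def sum.remove[of _ i])
  also have "(\<Sum>j\<in>UNIV - {i}. stress_matrix E \<omega> $ i $ j * x $ j)
      = (\<Sum>j\<in>neighbours E i. - \<omega> {i, j} * x $ j)"
    using nb by (intro sum.mono_neutral_cong_right) (auto simp: stress_matrix_def neighbours_def)
  finally show ?thesis
    by (simp add: stress_matrix_def[of E \<omega>] sum_distrib_right right_diff_distrib sum_subtractf sum_negf)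
qed

lemma equilibrium_stress_iff:
  fixes E :: "'n::finite set set"
  assumes "simple_graph E"
  shows "equilibrium_stress E d p \<omega> \<longleftrightarrow> (\<forall>c<d. stress_matrix E \<omega> *v (\<chi> i. p i c) = 0)"
proof -
  have "(\<Sum>j\<in>neighbours E i. \<omega> {i, j} * (p j c - p i c)) = - (stress_matrix E \<omega> *v (\<chi> i. p i c)) $ i" for i c
    by (simp add: stress_matrix_mult_vec[OF assms] algebra_simps flip: sum_negf)
  then show ?thesis by (auto simp: equilibrium_stress_def vec_eq_iff)
qed

lemma nonzero_stress_iff:
  fixes E :: "'n::finite set set"
  assumes "simple_graph E"
  shows "nonzero_stress E \<omega> \<longleftrightarrow> stress_matrix E \<omega> \<noteq> 0"
proof
  assume "nonzero_stress E \<omega>"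
  then obtain e where e: "e \<in> E" "\<omega> e \<noteq> 0" by (auto simp: nonzero_stress_def)
  then obtain i j where "e = {i, j}" "i \<noteq> j" using assms by (auto simp: simple_graph_def card_2_iff)
  then have "stress_matrix E \<omega> $ i $ j \<noteq> 0" using e by (simp add: stress_matrix_def)
  then show "stress_matrix E \<omega> \<noteq> 0" by auto
next
  assume "stress_matrix E \<omega> \<noteq> 0"
  show "nonzero_stress E \<omega>"
  proof (rule ccontr)
    assume "\<not> nonzero_stress E \<omega>"
    then have "stress_matrix E \<omega> = 0"
      by (auto simp: nonzero_stress_def stress_matrix_def vec_eq_iff neighbours_def intro!: sum.neutral)
    with \<open>stress_matrix E \<omega> \<noteq> 0\<close> show False by simp
  qed
qed

lemma stress_matrix_surj:
  fixes E :: "'n::finite set set" and L :: "real ^ 'n ^ 'n"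
  assumes "simple_graph E" "transpose L = L" "\<And>i j. i \<noteq> j \<Longrightarrow> {i, j} \<notin> E \<Longrightarrow> L $ i $ j = 0"
    "L *v (\<chi> i. 1) = 0"
  obtains \<omega> where "stress_matrix E \<omega> = L"
proof -
  have sym: "L $ i $ j = L $ j $ i" for i j
    using assms(2) by (metis transpose_def vec_lambda_beta)
  \<comment> \<open>The description is unambiguous because \<open>L\<close> is symmetric: both
    orderings of a pair give the same entry.\<close>
  define \<omega> where "\<omega> e = (THE x. \<exists>i j. e = {i, j} \<and> x = - L $ i $ j)" for e
  have \<omega>: "\<omega> {i, j} = - L $ i $ j" for i j
    unfolding \<omega>_def by (rule the_equality) (auto simp: doubleton_eq_iff sym)
  have "stress_matrix E \<omega> $ i $ j = L $ i $ j" for i j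
  proof (cases "i = j")
    case False
    then show ?thesis using assms(3) by (simp add: stress_matrix_def \<omega>)
  next
    case True
    have "{i, i} \<notin> E" using assms(1) by (auto simp: simple_graph_def)
    then have nb: "neighbours E i \<subseteq> UNIV - {i}" by (auto simp: neighbours_def)
    \<comment> \<open>The diagonal of a stress matrix is dictated by its off-diagonal entries; the
      vanishing row sums say that \<open>L\<close> has the same diagonal.\<close>
    have "0 = (L *v (\<chi> i. 1)) $ i" using assms(4) by simp
    also have "\<dots> = L $ i $ i + (\<Sum>j\<in>UNIV - {i}. L $ i $ j)"
      by (simp add: matrix_vector_mult_def sum.remove[of _ i])
    also have "(\<Sum>j\<in>UNIV - {i}. L $ i $ j) = (\<Sum>j\<in>neighbours E i. L $ i $ j)"
      using nb by (intro sum.mono_neutral_right) (auto simp: neighbours_def assms(3))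
    finally show ?thesis using True by (simp add: stress_matrix_def \<omega> sum_negf)
  qed
  then show ?thesis by (intro that[of \<omega>]) (simp add: vec_eq_iff)
qed

text \<open>This is \<open>D K D\<close> with \<open>D\<close> the diagonal matrix of
  \<open>u\<close>. For \<open>u\<close> without zero entries it preserves the sparsity pattern and
  semidefiniteness, while kernel vectors are divided entrywise by \<open>u\<close>.\<close>

definition diag_congruence :: "real ^ 'n \<Rightarrow> real ^ 'n ^ 'n \<Rightarrow> real ^ 'n ^ 'n" where
  "diag_congruence u K = (\<chi> i j. u $ i * K $ i $ j * u $ j)"

lemma diag_congruence_mult_vec:
  "diag_congruence u K *v x = (\<chi> i. u $ i * (K *v (\<chi> j. u $ j * x $ j)) $ i)"
  by (simp add: diag_congruence_def matrix_vector_mult_def vec_eq_iff sum_distrib_left mult_ac)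

lemma psd_diag_congruence:
  assumes "positive_semidefinite K"
  shows "positive_semidefinite (diag_congruence u K)"
  unfolding positive_semidefinite_def
proof (intro conjI allI)
  show "transpose (diag_congruence u K) = diag_congruence u K"
    using assms by (simp add: positive_semidefinite_def diag_congruence_def transpose_def vec_eq_iff mult_ac)
  fix x
  have "x \<bullet> (diag_congruence u K *v x) = (\<chi> j. u $ j * x $ j) \<bullet> (K *v (\<chi> j. u $ j * x $ j))"
    unfolding diag_congruence_mult_vec by (simp add: inner_vec_def mult_ac)
  then show "0 \<le> x \<bullet> (diag_congruence u K *v x)"
    using assms by (simp add: positive_semidefinite_def)
qed

lemma diag_congruence_eq_0_iff:
  "(\<And>i. u $ i \<noteq> 0) \<Longrightarrow> diag_congruence u K = 0 \<longleftrightarrow> K = 0"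
  by (simp add: diag_congruence_def vec_eq_iff)

text \<open>The last sample plays the role of the homogenizing coordinate: dividing by it turns
  the linear condition \<open>K X\<^sub>k = 0\<close> for \<open>k \<le> d\<close> into the affine equilibrium condition in
  dimension \<open>d\<close>.\<close>

lemma supports_psd_stress_dehomogenize:
  fixes E :: "'n::finite set set"
  assumes "simple_graph E" and nz: "\<And>i. X d $ i \<noteq> 0"
  shows "supports_psd_stress E d (\<lambda>i c. X c $ i / X d $ i) \<longleftrightarrow> annihilated_by_psd E (d + 1) X"
proof
  assume "supports_psd_stress E d (\<lambda>i c. X c $ i / X d $ i)"
  then obtain \<omega> where eq: "\<And>c. c < d \<Longrightarrow> stress_matrix E \<omega> *v (\<chi> i. X c $ i / X d $ i) = 0"
    and n0: "stress_matrix E \<omega> \<noteq> 0" and psd: "positive_semidefinite (stress_matrix E \<omega>)"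
    by (auto simp: supports_psd_stress_def equilibrium_stress_iff[OF assms(1)] nonzero_stress_iff[OF assms(1)])
  define K where "K = diag_congruence (\<chi> i. 1 / X d $ i) (stress_matrix E \<omega>)"
  \<comment> \<open>For \<open>c = d\<close> the vector is constantly one, and every stress matrix
    annihilates constants. This accounts for the extra sample.\<close>
  have "stress_matrix E \<omega> *v (\<chi> i. X c $ i / X d $ i) = 0" if "c < d + 1" for c
  proof (cases "c = d")
    case True
    then show ?thesis using nz by (simp add: vec_eq_iff stress_matrix_mult_vec[OF assms(1)])
  qed (use eq that in auto)
  then have "K *v X c = 0" if "c < d + 1" for c
    using that by (simp add: K_def diag_congruence_mult_vec vec_eq_iff)
  moreover have "K \<noteq> 0" unfolding K_def using n0 nz by (subst diag_congruence_eq_0_iff) auto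
  moreover have "positive_semidefinite K" unfolding K_def by (rule psd_diag_congruence[OF psd])
  moreover have "K $ i $ j = 0" if "i \<noteq> j \<and> {i, j} \<notin> E" for i j
    using that by (simp add: K_def diag_congruence_def stress_matrix_def)
  ultimately show "annihilated_by_psd E (d + 1) X" unfolding annihilated_by_psd_def by blast
next
  assume "annihilated_by_psd E (d + 1) X"
  then obtain K where K: "K \<noteq> 0" "positive_semidefinite K"
    "\<And>i j. i \<noteq> j \<and> {i, j} \<notin> E \<Longrightarrow> K $ i $ j = 0" "\<And>c. c < d + 1 \<Longrightarrow> K *v X c = 0"
    unfolding annihilated_by_psd_def by blast
  define L where "L = diag_congruence (X d) K"
  have L: "L *v (\<chi> i. X c $ i / X d $ i) = 0" if "c < d + 1" for c
    using K(4)[OF that] nz by (simp add: L_def diag_congruence_mult_vec vec_eq_iff)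
  have psd: "positive_semidefinite L" unfolding L_def by (rule psd_diag_congruence[OF K(2)])
  have "L *v (\<chi> i. 1) = 0" using L[of d] nz by simp
  then obtain \<omega> where \<omega>: "stress_matrix E \<omega> = L"
    using stress_matrix_surj[OF assms(1), of L] psd K(3)
    by (auto simp: positive_semidefinite_def L_def diag_congruence_def)
  have "L \<noteq> 0" unfolding L_def using K(1) nz by (subst diag_congruence_eq_0_iff) auto
  then show "supports_psd_stress E d (\<lambda>i c. X c $ i / X d $ i)"
    using L psd unfolding supports_psd_stress_def equilibrium_stress_iff[OF assms(1)] nonzero_stress_iff[OF assms(1)]
    by (intro exI[of _ \<omega>]) (simp add: \<omega>)
qed

lemma supports_psd_stress_cong:
  assumes "\<And>i c. c < d \<Longrightarrow> p i c = q i c"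
  shows "supports_psd_stress E d p \<longleftrightarrow> supports_psd_stress E d q"
  by (simp add: supports_psd_stress_def equilibrium_stress_def assms)

section \<open>Germs determined by their value at a generic point\<close>

abbreviation monomial_value :: "('i \<Rightarrow>\<^sub>0 nat) \<Rightarrow> ('i \<Rightarrow> real) \<Rightarrow> real" where
  "monomial_value m x \<equiv> (\<Prod>i \<in> Poly_Mapping.keys m. x i ^ Poly_Mapping.lookup m i)"

lemma monomial_value_superset:
  "finite S \<Longrightarrow> Poly_Mapping.keys m \<subseteq> S \<Longrightarrow> monomial_value m x = (\<Prod>i\<in>S. x i ^ Poly_Mapping.lookup m i)"
  by (rule prod.mono_neutral_left) (auto simp: in_keys_iff)

lemma monomial_value_add: "monomial_value (m + m') x = monomial_value m x * monomial_value m' x"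
proof -
  let ?S = "Poly_Mapping.keys m \<union> Poly_Mapping.keys m'"
  have "monomial_value (m + m') x = (\<Prod>i\<in>?S. x i ^ Poly_Mapping.lookup (m + m') i)"
    by (intro monomial_value_superset Poly_Mapping.keys_add) simp
  also have "\<dots> = (\<Prod>i\<in>?S. x i ^ Poly_Mapping.lookup m i) * (\<Prod>i\<in>?S. x i ^ Poly_Mapping.lookup m' i)"
    by (simp add: lookup_add power_add prod.distrib)
  also have "\<dots> = monomial_value m x * monomial_value m' x"
    by (intro arg_cong2[of _ _ _ _ "(*)"] monomial_value_superset[symmetric]) auto
  finally show ?thesis .
qed

text \<open>Terms may cancel in a sum of polynomials, so its support is compared with those of the
  summands over a common larger index set.\<close>

lemma eval_rat_poly_superset:
  "finite S \<Longrightarrow> Poly_Mapping.keys f \<subseteq> S \<Longrightarrow>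
    eval_rat_poly f x = (\<Sum>m\<in>S. of_rat (Poly_Mapping.lookup f m) * monomial_value m x)"
  unfolding eval_rat_poly_def by (rule sum.mono_neutral_left) (auto simp: in_keys_iff)

lemma eval_rat_poly_add: "eval_rat_poly (f + g) x = eval_rat_poly f x + eval_rat_poly g x"
proof -
  let ?S = "Poly_Mapping.keys f \<union> Poly_Mapping.keys g"
  have "Poly_Mapping.keys (f + g) \<subseteq> ?S" by (rule Poly_Mapping.keys_add)
  then show ?thesis
    by (simp add: eval_rat_poly_superset[of ?S] lookup_add of_rat_add distrib_right sum.distrib)
qed

lemma eval_rat_poly_0 [simp]: "eval_rat_poly 0 x = 0"
  by (simp add: eval_rat_poly_def)

lemma eval_rat_poly_single:
  "eval_rat_poly (Poly_Mapping.single m c) x = of_rat c * monomial_value m x"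
  by (simp add: eval_rat_poly_superset[of "{m}"])

lemma eval_rat_poly_sum: "eval_rat_poly (\<Sum>a\<in>A. f a) x = (\<Sum>a\<in>A. eval_rat_poly (f a) x)"
  by (induction A rule: infinite_finite_induct) (simp_all add: eval_rat_poly_add)

lemma sum_single_keys: "(\<Sum>m\<in>Poly_Mapping.keys f. Poly_Mapping.single m (Poly_Mapping.lookup f m)) = f"
  by (rule poly_mapping_eqI) (auto simp: lookup_sum lookup_single when_def in_keys_iff)

lemma eval_rat_poly_mult: "eval_rat_poly (f * g) x = eval_rat_poly f x * eval_rat_poly g x"
proof -
  have "f * g = (\<Sum>m\<in>Poly_Mapping.keys f. Poly_Mapping.single m (Poly_Mapping.lookup f m)) *
      (\<Sum>m\<in>Poly_Mapping.keys g. Poly_Mapping.single m (Poly_Mapping.lookup g m))"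
    by (simp only: sum_single_keys)
  also have "eval_rat_poly \<dots> x = (\<Sum>m\<in>Poly_Mapping.keys f. \<Sum>m'\<in>Poly_Mapping.keys g.
      (of_rat (Poly_Mapping.lookup f m) * monomial_value m x) *
      (of_rat (Poly_Mapping.lookup g m') * monomial_value m' x))"
    by (simp add: sum_product eval_rat_poly_sum mult_single eval_rat_poly_single monomial_value_add
        of_rat_mult mult_ac)
  also have "\<dots> = eval_rat_poly f x * eval_rat_poly g x"
    by (simp add: eval_rat_poly_def sum_product)
  finally show ?thesis .
qed

text \<open>Members that agree at \<open>z0\<close> agree eventually along \<open>G\<close>. Thus
  \<open>eventually_zero\<close> makes equations persist, and \<open>tendsto\<close> does the same
  for strict inequalities. The members need not be continuous anywhere else.\<close>

locale germ_ring =
  fixes G :: "'z filter" and z0 :: 'z and F :: "('z \<Rightarrow> real) set"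
  assumes one: "(\<lambda>_. 1) \<in> F"
    and add: "\<And>f g. f \<in> F \<Longrightarrow> g \<in> F \<Longrightarrow> (\<lambda>z. f z + g z) \<in> F"
    and mult: "\<And>f g. f \<in> F \<Longrightarrow> g \<in> F \<Longrightarrow> (\<lambda>z. f z * g z) \<in> F"
    and minus: "\<And>f. f \<in> F \<Longrightarrow> (\<lambda>z. - f z) \<in> F"
    and tendsto: "\<And>f. f \<in> F \<Longrightarrow> (f \<longlongrightarrow> f z0) G"
    and eventually_zero: "\<And>f. f \<in> F \<Longrightarrow> f z0 = 0 \<Longrightarrow> eventually (\<lambda>z. f z = 0) G"
begin

lemma zero: "(\<lambda>_. 0) \<in> F"
  using add[OF one minus[OF one]] by simp

lemma diff: "f \<in> F \<Longrightarrow> g \<in> F \<Longrightarrow> (\<lambda>z. f z - g z) \<in> F"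
  using add[OF _ minus, of f g] by simp

lemma sum: "(\<And>a. a \<in> A \<Longrightarrow> f a \<in> F) \<Longrightarrow> (\<lambda>z. \<Sum>a\<in>A. f a z) \<in> F"
  by (induction A rule: infinite_finite_induct) (auto intro: zero add)

lemma of_nat: "(\<lambda>_. of_nat n) \<in> F"
  by (induction n) (auto intro: zero add one)

text \<open>Polynomials over \<open>F\<close> are represented as real polynomials depending on the parameter.\<close>

definition poly_families :: "('z \<Rightarrow> real poly) set" where
  "poly_families = {P. (\<forall>i. (\<lambda>z. coeff (P z) i) \<in> F) \<and> (\<exists>n. \<forall>z. degree (P z) \<le> n)}"

lemma poly_families_add:
  assumes "P \<in> poly_families" "Q \<in> poly_families"
  shows "(\<lambda>z. P z + Q z) \<in> poly_families"
proof -
  obtain m n where "\<And>z. degree (P z) \<le> m" "\<And>z. degree (Q z) \<le> n"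
    using assms by (auto simp: poly_families_def)
  then have "degree (P z + Q z) \<le> max m n" for z
    by (intro degree_add_le) (auto simp: le_max_iff_disj)
  then show ?thesis using assms by (auto simp: poly_families_def intro!: add)
qed

lemma poly_families_minus: "P \<in> poly_families \<Longrightarrow> (\<lambda>z. - P z) \<in> poly_families"
  by (auto simp: poly_families_def intro: minus)

lemma poly_families_mult:
  assumes "P \<in> poly_families" "Q \<in> poly_families"
  shows "(\<lambda>z. P z * Q z) \<in> poly_families"
proof -
  obtain m n where "\<And>z. degree (P z) \<le> m" "\<And>z. degree (Q z) \<le> n"
    using assms by (auto simp: poly_families_def)
  then have "degree (P z * Q z) \<le> m + n" for z
    by (meson add_mono degree_mult_le le_trans)
  then show ?thesis using assms
    by (auto simp: poly_families_def coeff_mult intro!: sum mult)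
qed

lemma poly_families_const: "f \<in> F \<Longrightarrow> (\<lambda>z. [:f z:]) \<in> poly_families"
proof -
  assume "f \<in> F"
  then have "(\<lambda>z. coeff [:f z:] i) \<in> F" for i by (cases i) (simp_all add: zero)
  then show ?thesis by (auto simp: poly_families_def)
qed

lemma poly_families_monom: "f \<in> F \<Longrightarrow> (\<lambda>z. monom (f z) k) \<in> poly_families"
proof -
  assume "f \<in> F"
  then have "(\<lambda>z. coeff (monom (f z) k) i) \<in> F" for i by (cases "k = i") (simp_all add: zero)
  then show ?thesis by (auto simp: poly_families_def intro!: exI[of _ k] degree_monom_le)
qed

lemma poly_families_pderiv: 
  assumes "P \<in> poly_families" shows "(\<lambda>z. pderiv (P z)) \<in> poly_families"
proof -
  obtain m where "\<And>z. degree (P z) \<le> m" using assms by (auto simp: poly_families_def)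
  then have "degree (pderiv (P z)) \<le> m" for z
    by (metis degree_pderiv diff_le_self le_trans)
  then show ?thesis using assms
    by (auto simp: poly_families_def coeff_pderiv simp del: of_nat_Suc intro!: mult of_nat)
qed

lemma poly_eq_sum_le: "degree p \<le> n \<Longrightarrow> poly p x = (\<Sum>i\<le>n. coeff p i * x ^ i)" for p :: "real poly"
  unfolding poly_altdef by (rule sum.mono_neutral_left) (auto simp: coeff_eq_0)

lemma poly_families_tendsto:
  assumes "P \<in> poly_families" "(g \<longlongrightarrow> g z0) G"
  shows "((\<lambda>z. poly (P z) (g z)) \<longlongrightarrow> poly (P z0) (g z0)) G"
proof -
  obtain n where n: "\<And>z. degree (P z) \<le> n" using assms by (auto simp: poly_families_def)
  have "((\<lambda>z. coeff (P z) i) \<longlongrightarrow> coeff (P z0) i) G" for i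
    using assms(1) tendsto by (auto simp: poly_families_def)
  then show ?thesis unfolding poly_eq_sum_le[OF n] by (intro tendsto_intros assms(2))
qed

text \<open>The uniform degree bound leaves finitely many coefficients, so their eventual vanishing
  can be combined.\<close>

lemma poly_families_eventually_zero:
  assumes "P \<in> poly_families" "P z0 = 0"
  shows "eventually (\<lambda>z. P z = 0) G"
proof -
  obtain n where n: "\<And>z. degree (P z) \<le> n" using assms by (auto simp: poly_families_def)
  have "eventually (\<lambda>z. coeff (P z) i = 0) G" for i
    using assms by (intro eventually_zero) (auto simp: poly_families_def)
  then have "eventually (\<lambda>z. \<forall>i\<in>{..n}. coeff (P z) i = 0) G"
    by (intro eventually_ball_finite) auto
  then show ?thesis
    by eventually_elim (metis n atMost_iff leading_coeff_0_iff)
qed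

text \<open>The new ring is \<open>F[g]\<close>, the functions \<open>poly (P z) (g z)\<close>. The
  two assumptions supply its \<open>tendsto\<close> and \<open>eventually_zero\<close>
  conditions.\<close>

lemma adjoin_function:
  assumes "(g \<longlongrightarrow> g z0) G"
    and "\<And>P. P \<in> poly_families \<Longrightarrow> poly (P z0) (g z0) = 0 \<Longrightarrow> eventually (\<lambda>z. poly (P z) (g z) = 0) G"
  obtains F' where "germ_ring G z0 F'" "F \<subseteq> F'" "g \<in> F'"
proof
  let ?F = "(\<lambda>P z. poly (P z) (g z)) ` poly_families"
  show "germ_ring G z0 ?F"
  proof
    show "(\<lambda>_. 1) \<in> ?F" using poly_families_const[OF one] by (rule rev_image_eqI) simp
    fix f assume "f \<in> ?F"
    then obtain P where P: "P \<in> poly_families" "f = (\<lambda>z. poly (P z) (g z))" by blast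
    show "(\<lambda>z. - f z) \<in> ?F" using poly_families_minus[OF P(1)] by (rule rev_image_eqI) (simp add: P)
    show "(f \<longlongrightarrow> f z0) G" using poly_families_tendsto[OF P(1) assms(1)] by (simp add: P)
    show "eventually (\<lambda>z. f z = 0) G" if "f z0 = 0" using that assms(2)[OF P(1)] by (simp add: P)
    fix h assume "h \<in> ?F"
    then obtain Q where Q: "Q \<in> poly_families" "h = (\<lambda>z. poly (Q z) (g z))" by blast
    show "(\<lambda>z. f z + h z) \<in> ?F"
      using poly_families_add[OF P(1) Q(1)] by (rule rev_image_eqI) (simp add: P Q)
    show "(\<lambda>z. f z * h z) \<in> ?F"
      using poly_families_mult[OF P(1) Q(1)] by (rule rev_image_eqI) (simp add: P Q)
  qed
  show "F \<subseteq> ?F"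
  proof
    fix f assume "f \<in> F"
    then show "f \<in> ?F" by (intro rev_image_eqI[OF poly_families_const]) auto
  qed
  show "g \<in> ?F"
    using poly_families_monom[OF one, of 1] by (rule rev_image_eqI) (simp add: poly_monom)
qed

text \<open>If \<open>y\<close> is algebraic over the values at \<open>z0\<close>, it is a simple root of a polynomial of
  minimal degree, and the nearest root of the perturbed polynomial extends \<open>y\<close>.
  If \<open>y\<close> is transcendental, the constant function \<open>y\<close> will do.\<close>

lemma adjoin_value:
  obtains F' g where "germ_ring G z0 F'" "F \<subseteq> F'" "g \<in> F'" "g z0 = y"
proof (cases "\<exists>P\<in>poly_families. P z0 \<noteq> 0 \<and> poly (P z0) y = 0")
  case False
  \<comment> \<open>By transcendence the polynomial \<open>P z0\<close> is zero, so
    \<open>P z\<close> is eventually the zero polynomial.\<close>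
  have "eventually (\<lambda>z. poly (P z) y = 0) G" if "P \<in> poly_families" "poly (P z0) y = 0" for P
    using eventually_mono[OF poly_families_eventually_zero[OF that(1)]] False that by force
  then obtain F' where "germ_ring G z0 F'" "F \<subseteq> F'" "(\<lambda>_. y) \<in> F'"
    using adjoin_function[of "\<lambda>_. y"] by auto
  then show ?thesis using that by blast
next
  case True
  define S where "S P \<longleftrightarrow> P \<in> poly_families \<and> P z0 \<noteq> 0 \<and> poly (P z0) y = 0" for P
  from True obtain P0 where "S P0" by (auto simp: S_def)
  then obtain P where "S P" "\<And>Q. S Q \<Longrightarrow> degree (P z0) \<le> degree (Q z0)"
    using ex_has_least_nat[of S P0 "\<lambda>P. degree (P z0)"] by blast
  then have P: "P \<in> poly_families" "P z0 \<noteq> 0" "poly (P z0) y = 0"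
    and min: "\<And>Q. Q \<in> poly_families \<Longrightarrow> Q z0 \<noteq> 0 \<Longrightarrow> poly (Q z0) y = 0 \<Longrightarrow> degree (P z0) \<le> degree (Q z0)"
    by (auto simp: S_def)
  define D where "D = degree (P z0)"
  have "D \<noteq> 0"
  proof
    assume "D = 0"
    then obtain c where "P z0 = [:c:]" unfolding D_def by (metis degree_eq_zeroE)
    with P show False by simp
  qed
  define R where "R z = {x. poly (P z) x = 0}" for z
  \<comment> \<open>The default \<open>y\<close> is harmless: by \<open>near\<close> below, roots
    eventually exist along \<open>G\<close>.\<close>
  define g where "g z = (if R z = {} then y else closest_point (R z) y)" for z
  have closedR: "closed (R z)" for z
    unfolding R_def by (intro closed_Collect_eq continuous_intros)
  have g_root: "poly (P z) (g z) = 0" if "R z \<noteq> {}" for z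
    using closest_point_in_set[OF closedR that] that by (simp add: g_def R_def)
  have g_le: "\<bar>g z - y\<bar> \<le> \<bar>r - y\<bar>" if "poly (P z) r = 0" for z r
    using closest_point_le[OF closedR, of r z y] that
    by (auto simp: g_def R_def dist_real_def abs_minus_commute)
  have gz0: "g z0 = y" using g_le[OF P(3)] by simp
  \<comment> \<open>Minimality makes the root simple: the derivative is again a family over
    \<open>F\<close>, non-zero at \<open>z0\<close> and of smaller degree there.\<close>
  have deriv: "poly (pderiv (P z0)) y \<noteq> 0"
  proof
    assume "poly (pderiv (P z0)) y = 0"
    moreover have "pderiv (P z0) \<noteq> 0" using \<open>D \<noteq> 0\<close> by (simp add: D_def pderiv_eq_0_iff)
    ultimately have "D \<le> degree (pderiv (P z0))"
      using min[OF poly_families_pderiv[OF P(1)]] by (simp add: D_def)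
    with \<open>D \<noteq> 0\<close> show False by (simp add: degree_pderiv D_def)
  qed
  have near: "eventually (\<lambda>z. R z \<noteq> {} \<and> \<bar>g z - y\<bar> < \<epsilon>) G" if "\<epsilon> > 0" for \<epsilon>
  proof -
    \<comment> \<open>A simple root comes with a sign change. The opposite signs at
      \<open>y - h\<close> and \<open>y + h\<close> persist, and the intermediate value theorem
      places a root between these two points.\<close>
    obtain h where h: "0 < h" "h < \<epsilon>" "poly (P z0) (y - h) * poly (P z0) (y + h) < 0"
    proof -
      have D: "DERIV (poly (P z0)) y :> poly (pderiv (P z0)) y" by (rule poly_DERIV)
      consider "poly (pderiv (P z0)) y > 0" | "poly (pderiv (P z0)) y < 0" using deriv by linarith
      then show ?thesis
      proof cases
        case 1
        obtain d1 d2 where "d1 > 0" "d2 > 0"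
          "\<And>h. 0 < h \<Longrightarrow> h < d1 \<Longrightarrow> poly (P z0) y < poly (P z0) (y + h)"
          "\<And>h. 0 < h \<Longrightarrow> h < d2 \<Longrightarrow> poly (P z0) (y - h) < poly (P z0) y"
          using DERIV_pos_inc_right[OF D 1] DERIV_pos_inc_left[OF D 1] by blast
        moreover obtain h where "0 < h" "h < min \<epsilon> (min d1 d2)"
          using dense[of 0 "min \<epsilon> (min d1 d2)"] that calculation \<open>\<epsilon> > 0\<close> by auto
        ultimately show ?thesis using P(3) by (intro that[of h]) (auto simp: mult_less_0_iff)
      next
        case 2
        obtain d1 d2 where "d1 > 0" "d2 > 0"
          "\<And>h. 0 < h \<Longrightarrow> h < d1 \<Longrightarrow> poly (P z0) y > poly (P z0) (y + h)"
          "\<And>h. 0 < h \<Longrightarrow> h < d2 \<Longrightarrow> poly (P z0) (y - h) > poly (P z0) y"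
          using DERIV_neg_dec_right[OF D 2] DERIV_neg_dec_left[OF D 2] by blast
        moreover obtain h where "0 < h" "h < min \<epsilon> (min d1 d2)"
          using dense[of 0 "min \<epsilon> (min d1 d2)"] that calculation \<open>\<epsilon> > 0\<close> by auto
        ultimately show ?thesis using P(3) by (intro that[of h]) (auto simp: mult_less_0_iff)
      qed
    qed
    have "((\<lambda>z. poly (P z) (y - h) * poly (P z) (y + h)) \<longlongrightarrow>
        poly (P z0) (y - h) * poly (P z0) (y + h)) G"
      using poly_families_tendsto[OF P(1), of "\<lambda>_. y - h"] poly_families_tendsto[OF P(1), of "\<lambda>_. y + h"]
      by (intro tendsto_mult) simp_all
    then have "eventually (\<lambda>z. poly (P z) (y - h) * poly (P z) (y + h) < 0) G"
      using h(3) by (rule order_tendstoD)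
    then show ?thesis
    proof eventually_elim
      case (elim z)
      obtain r where r: "y - h < r" "r < y + h" "poly (P z) r = 0"
        using poly_IVT[OF _ elim] h(1) by auto
      have "R z \<noteq> {}" using r(3) by (auto simp: R_def)
      moreover have "\<bar>g z - y\<bar> < \<epsilon>" using g_le[OF r(3)] r(1,2) h(2) by linarith
      ultimately show ?case by simp
    qed
  qed
  have g_lim: "(g \<longlongrightarrow> g z0) G"
    unfolding gz0 tendsto_iff dist_real_def by (auto intro: eventually_mono[OF near])
  have root: "eventually (\<lambda>z. poly (P z) (g z) = 0) G"
    by (rule eventually_mono[OF near[of 1]]) (simp_all add: g_root)
  have coeff_F: "(\<lambda>z. coeff (Q z) i) \<in> F" if "Q \<in> poly_families" for Q i
    using that by (simp add: poly_families_def)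
  have lc: "eventually (\<lambda>z. coeff (P z) D \<noteq> 0) G"
    by (rule tendsto_imp_eventually_ne[OF tendsto[OF coeff_F[OF P(1)]]]) (use P(2) in \<open>simp add: D_def\<close>)
  have "eventually (\<lambda>z. poly (Q z) (g z) = 0) G" if "Q \<in> poly_families" "poly (Q z0) (g z0) = 0" for Q
    using that
  proof (induction "degree (Q z0)" arbitrary: Q rule: less_induct)
    case less
    define k where "k = degree (Q z0)"
    show ?case
    proof (cases "Q z0 = 0")
      case True
      then show ?thesis
        using poly_families_eventually_zero[OF less.prems(1)] by (auto elim: eventually_mono)
    next
      case False
      have Dk: "D \<le> k" using min[OF less.prems(1) False] less.prems(2) gz0 by (simp add: D_def k_def)
      \<comment> \<open>Pseudo-division: \<open>F\<close> need not be a field, so \<open>Q\<close>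
        is multiplied by the leading coefficient of \<open>P\<close> at \<open>z0\<close> before the
        top terms are cancelled. This factor is eventually non-zero by \<open>lc\<close> and can be
        removed again. The numbers \<open>D\<close> and \<open>k\<close> are degrees at
        \<open>z0\<close>; elsewhere only the identity \<open>Q'_poly\<close> matters.\<close>
      define Q' where "Q' z = [:coeff (P z) D:] * Q z + - (monom (coeff (Q z) k) (k - D) * P z)" for z
      have Q'_fam: "Q' \<in> poly_families"
        unfolding Q'_def
        by (intro poly_families_add poly_families_minus poly_families_mult poly_families_const
            poly_families_monom coeff_F less.prems(1) P(1))
      have Q'_poly: "poly (Q' z) x = coeff (P z) D * poly (Q z) x - coeff (Q z) k * x ^ (k - D) * poly (P z) x" for z x
        by (simp add: Q'_def poly_monom)
      have Q'_root: "poly (Q' z0) (g z0) = 0"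
        using less.prems(2) P(3) gz0 by (simp add: Q'_poly)
      have Q'_deg: "degree (Q' z0) \<le> k"
        unfolding Q'_def using Dk
        by (intro degree_add_le order_trans[OF degree_mult_le])
          (auto simp: k_def D_def intro!: order_trans[OF degree_mult_le] order_trans[OF add_mono[OF degree_monom_le order_refl]])
      have "coeff (Q' z0) k = 0"
        using Dk by (simp add: Q'_def coeff_monom_mult)
      then have "degree (Q' z0) < k \<or> Q' z0 = 0"
        using Q'_deg by (metis leading_coeff_0_iff le_neq_implies_less)
      then have "eventually (\<lambda>z. poly (Q' z) (g z) = 0) G"
      proof
        assume "degree (Q' z0) < k"
        then show ?thesis using less.hyps Q'_fam Q'_root by (simp add: k_def)
      next
        assume "Q' z0 = 0"
        then show ?thesis using poly_families_eventually_zero[OF Q'_fam] by (auto elim: eventually_mono)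
      qed
      with root lc show ?thesis
        by eventually_elim (simp add: Q'_poly)
    qed
  qed
  then obtain F' where "germ_ring G z0 F'" "F \<subseteq> F'" "g \<in> F'"
    using adjoin_function[OF g_lim] by blast
  with gz0 show ?thesis using that by blast
qed

end

lemma germ_ring_adjoin_finite:
  assumes "germ_ring G z0 F" "finite Y"
  obtains F' where "germ_ring G z0 F'" "F \<subseteq> F'" "\<And>y. y \<in> Y \<Longrightarrow> \<exists>g\<in>F'. g z0 = y"
  using assms(2) assms(1)
proof (induction Y arbitrary: thesis rule: finite_induct)
  case empty
  then show ?case by blast
next
  case (insert y Y)
  obtain F1 where F1: "germ_ring G z0 F1" "F \<subseteq> F1" "\<And>y. y \<in> Y \<Longrightarrow> \<exists>g\<in>F1. g z0 = y"
    using insert by metis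
  obtain F2 g where "germ_ring G z0 F2" "F1 \<subseteq> F2" "g \<in> F2" "g z0 = y"
    using germ_ring.adjoin_value[OF F1(1)] by metis
  then show ?case using F1 by (intro insert.prems(1)[of F2]) blast+
qed

section \<open>Persistence of semidefiniteness\<close>

definition quad_form :: "'i set \<Rightarrow> ('i \<Rightarrow> 'i \<Rightarrow> real) \<Rightarrow> ('i \<Rightarrow> real) \<Rightarrow> real" where
  "quad_form A K x = (\<Sum>i\<in>A. \<Sum>j\<in>A. K i j * x i * x j)"

text \<open>Splitting off one index drives the induction, for which the form is restricted to a
  subset of the index type.\<close>

lemma quad_form_insert:
  assumes "finite A" "a \<notin> A" "\<And>i j. K i j = K j i"
  shows "quad_form (insert a A) K x
    = K a a * (x a)\<^sup>2 + 2 * x a * (\<Sum>j\<in>A. K a j * x j) + quad_form A K x"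
proof -
  have "(\<Sum>i\<in>A. K i a * x i * x a) = x a * (\<Sum>j\<in>A. K a j * x j)"
    "(\<Sum>j\<in>A. K a j * x a * x j) = x a * (\<Sum>j\<in>A. K a j * x j)"
    by (simp_all add: sum_distrib_left assms(3)[of _ a] mult_ac)
  then show ?thesis
    using assms(1,2) by (simp add: quad_form_def sum.distrib power2_eq_square mult_ac)
qed

text \<open>The usual Schur complement is multiplied by the pivot \<open>K a a\<close>. This avoids
  division, so the entries stay in a ring.\<close>

lemma quad_form_Schur_complement:
  assumes "\<And>i j. K i j = K j i"
  shows "quad_form A (\<lambda>i j. K a a * K i j - K a i * K a j) x
    = K a a * quad_form A K x - (\<Sum>j\<in>A. K a j * x j)\<^sup>2"
  by (simp add: quad_form_def left_diff_distrib right_diff_distrib sum_subtractf sum_distrib_left sum_product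
      power2_eq_square mult_ac)

lemma psd_iff_quad_form:
  fixes K :: "real ^ 'n ^ 'n"
  assumes "transpose K = K"
  shows "positive_semidefinite K \<longleftrightarrow> (\<forall>x. 0 \<le> quad_form UNIV (\<lambda>i j. K $ i $ j) x)"
proof -
  have eq: "x \<bullet> (K *v x) = quad_form UNIV (\<lambda>i j. K $ i $ j) (($) x)" for x
    by (simp add: quad_form_def inner_vec_def matrix_vector_mult_def sum_distrib_left mult_ac)
  have "(\<forall>x. 0 \<le> quad_form UNIV (\<lambda>i j. K $ i $ j) (($) x)) \<longleftrightarrow>
      (\<forall>x. 0 \<le> quad_form UNIV (\<lambda>i j. K $ i $ j) x)"
  proof (intro iffI allI)
    fix x assume "\<forall>x. 0 \<le> quad_form UNIV (\<lambda>i j. K $ i $ j) (($) x)"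
    from spec[OF this, of "\<chi> i. x i"] show "0 \<le> quad_form UNIV (\<lambda>i j. K $ i $ j) x"
      by (simp add: vec_lambda_inverse)
  qed simp
  then show ?thesis using assms by (simp add: positive_semidefinite_def eq)
qed

text \<open>Lagrange reduction decides semidefiniteness by finitely many sign conditions on
  polynomials in the entries, and signs of elements of a germ ring are locally constant.\<close>

lemma (in germ_ring) eventually_quad_form_nonneg:
  fixes K :: "'z \<Rightarrow> 'i \<Rightarrow> 'i \<Rightarrow> real"
  assumes "finite A" "\<And>i j. (\<lambda>z. K z i j) \<in> F" "\<And>z i j. K z i j = K z j i"
    "\<And>x. 0 \<le> quad_form A (K z0) x"
  shows "eventually (\<lambda>z. \<forall>x. 0 \<le> quad_form A (K z) x) G"
  using assms
proof (induction A arbitrary: K rule: finite_induct)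
  case empty
  then show ?case by (simp add: quad_form_def)
next
  case (insert a A)
  note K_F = insert.prems(1) and sym = insert.prems(2) and nonneg = insert.prems(3)
  note ins = quad_form_insert[OF insert.hyps(1,2) sym]
  define L where "L z x = (\<Sum>j\<in>A. K z a j * x j)" for z and x :: "'i \<Rightarrow> real"
  have upd: "quad_form (insert a A) (K z0) (x(a := t))
      = quad_form A (K z0) x + 2 * L z0 x * t + K z0 a a * t\<^sup>2" for x t
  proof -
    have "quad_form A (K z0) (x(a := t)) = quad_form A (K z0) x" "L z0 (x(a := t)) = L z0 x"
      using insert.hyps(2) by (auto simp: quad_form_def L_def intro!: sum.cong)
    then show ?thesis by (simp add: ins L_def)
  qed
  have disc: "(L z0 x)\<^sup>2 \<le> quad_form A (K z0) x * K z0 a a" for x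
  proof (rule quadratic_nonneg_discriminant)
    show "0 \<le> quad_form A (K z0) x + 2 * L z0 x * t + K z0 a a * t\<^sup>2" for t
      using nonneg[of "x(a := t)"] by (simp only: upd)
  qed
  have A_nonneg: "0 \<le> quad_form A (K z0) x" for x
    using nonneg[of "x(a := 0)", unfolded upd] by simp
  have Kaa: "0 \<le> K z0 a a"
    using nonneg[of "(\<lambda>_. 0)(a := 1)", unfolded upd] by (simp add: quad_form_def L_def)
  show ?case
  proof (cases "K z0 a a = 0")
    case True
    \<comment> \<open>A zero pivot forces the linear form \<open>L z0\<close> to vanish by
      \<open>disc\<close>. Hence row \<open>a\<close> is zero at \<open>z0\<close>, and these
      equations persist, so that the pivot cannot turn negative nearby.\<close>
    have "K z0 a j = 0" if "j \<in> A" for j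
    proof -
      have "L z0 (\<lambda>i. if i = j then 1 else 0) = K z0 a j"
        using that insert.hyps(1) by (simp add: L_def if_distrib[where f = "\<lambda>t. _ * t"] cong: if_cong)
      then show ?thesis using disc[of "\<lambda>i. if i = j then 1 else 0"] True by simp
    qed
    then have "eventually (\<lambda>z. \<forall>j\<in>A. K z a j = 0) G"
      using insert.hyps(1) by (intro eventually_ball_finite ballI eventually_zero K_F) auto
    moreover have "eventually (\<lambda>z. K z a a = 0) G"
      using True by (intro eventually_zero K_F)
    moreover have "eventually (\<lambda>z. \<forall>x. 0 \<le> quad_form A (K z) x) G"
      by (rule insert.IH[OF K_F sym A_nonneg])
    ultimately show ?thesis
      by eventually_elim (simp add: ins)
  next
    case False
    define K' where "K' z i j = K z a a * K z i j - K z a i * K z a j" for z i j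
    have K': "quad_form A (K' z) x = K z a a * quad_form A (K z) x - (L z x)\<^sup>2" for z x
      using quad_form_Schur_complement[of "K z", OF sym] by (simp add: K'_def[abs_def] L_def)
    have "eventually (\<lambda>z. \<forall>x. 0 \<le> quad_form A (K' z) x) G"
    proof (rule insert.IH)
      show "(\<lambda>z. K' z i j) \<in> F" for i j
        unfolding K'_def by (intro diff mult K_F)
      show "K' z i j = K' z j i" for z i j
        using sym[of z i j] by (simp add: K'_def)
      show "0 \<le> quad_form A (K' z0) x" for x
        using disc[of x] by (simp add: K' mult.commute)
    qed
    moreover have "eventually (\<lambda>z. 0 < K z a a) G"
      using False Kaa by (intro order_tendstoD[OF tendsto[OF K_F]]) simp
    ultimately show ?thesis
    proof eventually_elim
      case (elim z)
      show ?case
      proof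
        fix x
        have "quad_form (insert a A) (K z) x
            = K z a a * (x a)\<^sup>2 + 2 * x a * L z x + quad_form A (K z) x"
          unfolding L_def by (rule ins)
        \<comment> \<open>Completing the square, multiplied through by the positive pivot.\<close>
        then have "K z a a * quad_form (insert a A) (K z) x
            = (K z a a * x a + L z x)\<^sup>2 + quad_form A (K' z) x"
          by (simp add: K' algebra_simps power2_eq_square)
        also have "\<dots> \<ge> 0" using elim by simp
        finally show "0 \<le> quad_form (insert a A) (K z) x"
          using elim by (simp add: zero_le_mult_iff)
      qed
    qed
  qed
qed

text \<open>Genericity gives \<open>eventually_zero\<close> in the strongest form: a rational
  polynomial that vanishes at \<open>q z0\<close> is the zero polynomial.\<close>

lemma germ_ring_rat_polys:
  fixes q :: "'z \<Rightarrow> 'i \<Rightarrow> real"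
  assumes "algebraically_independent I (q z0)"
    and "\<And>i. i \<in> I \<Longrightarrow> ((\<lambda>z. q z i) \<longlongrightarrow> q z0 i) G"
  shows "germ_ring G z0 {\<lambda>z. eval_rat_poly f (q z) | f. \<forall>m\<in>Poly_Mapping.keys f. Poly_Mapping.keys m \<subseteq> I}"
    (is "germ_ring G z0 ?F")
proof
  have FI: "(\<lambda>z. eval_rat_poly f (q z)) \<in> ?F"
    if "\<forall>m\<in>Poly_Mapping.keys f. Poly_Mapping.keys m \<subseteq> I" for f
    using that by blast
  show "(\<lambda>_. 1) \<in> ?F"
    using FI[of "Poly_Mapping.single 0 1"] by (simp add: eval_rat_poly_single del: single_one)
  fix g assume "g \<in> ?F"
  then obtain f where f: "\<And>m. m \<in> Poly_Mapping.keys f \<Longrightarrow> Poly_Mapping.keys m \<subseteq> I"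
    and g: "g = (\<lambda>z. eval_rat_poly f (q z))" by blast
  have eq: "eval_rat_poly (Poly_Mapping.single 0 (- 1) * f) (q z) = - g z" for z
    by (simp add: eval_rat_poly_mult eval_rat_poly_single g)
  have "Poly_Mapping.keys (Poly_Mapping.single 0 (- 1) * f) \<subseteq> Poly_Mapping.keys f"
    using keys_mult[of "Poly_Mapping.single 0 (- 1)" f] by auto
  then have "\<forall>m\<in>Poly_Mapping.keys (Poly_Mapping.single 0 (- 1) * f). Poly_Mapping.keys m \<subseteq> I"
    using f by blast
  from FI[OF this] show "(\<lambda>z. - g z) \<in> ?F" by (simp only: eq)
  have "((\<lambda>z. eval_rat_poly f (q z)) \<longlongrightarrow> eval_rat_poly f (q z0)) G"
    unfolding eval_rat_poly_def using f by (intro tendsto_intros assms(2)) auto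
  then show "(g \<longlongrightarrow> g z0) G" by (simp add: g)
  show "eventually (\<lambda>z. g z = 0) G" if "g z0 = 0"
  proof -
    have "f = 0" using assms(1) f that unfolding algebraically_independent_def g by blast
    then show ?thesis by (simp add: g)
  qed
  fix g' assume "g' \<in> ?F"
  then obtain f' where f': "\<And>m. m \<in> Poly_Mapping.keys f' \<Longrightarrow> Poly_Mapping.keys m \<subseteq> I"
    and g': "g' = (\<lambda>z. eval_rat_poly f' (q z))" by blast
  have "\<forall>m\<in>Poly_Mapping.keys (f + f'). Poly_Mapping.keys m \<subseteq> I"
    using f f' Poly_Mapping.keys_add[of f f'] by blast
  from FI[OF this] show "(\<lambda>z. g z + g' z) \<in> ?F" by (simp add: g g' eval_rat_poly_add)
  have "\<forall>m\<in>Poly_Mapping.keys (f * f'). Poly_Mapping.keys m \<subseteq> I"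
  proof
    fix m assume "m \<in> Poly_Mapping.keys (f * f')"
    then obtain a b where "m = a + b" "a \<in> Poly_Mapping.keys f" "b \<in> Poly_Mapping.keys f'"
      using keys_mult[of f f'] by blast
    then show "Poly_Mapping.keys m \<subseteq> I" using f f' Poly_Mapping.keys_add[of a b] by blast
  qed
  from FI[OF this] show "(\<lambda>z. g z * g' z) \<in> ?F" by (simp add: g g' eval_rat_poly_mult)
qed

lemma eventually_supports_psd_stress:
  fixes E :: "'n::finite set set" and q :: "'z \<Rightarrow> 'n \<Rightarrow> nat \<Rightarrow> real"
  assumes "simple_graph E" "generic_framework d (q z0)" "supports_psd_stress E d (q z0)"
    and lim: "\<And>i c. c < d \<Longrightarrow> ((\<lambda>z. q z i c) \<longlongrightarrow> q z0 i c) G"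
  shows "eventually (\<lambda>z. supports_psd_stress E d (q z)) G"
proof -
  obtain \<omega> where \<omega>: "equilibrium_stress E d (q z0) \<omega>" "nonzero_stress E \<omega>"
    "positive_semidefinite (stress_matrix E \<omega>)"
    using assms(3) unfolding supports_psd_stress_def by blast
  define I where "I = (UNIV :: 'n set) \<times> {..<d}"
  define F0 where "F0 = {\<lambda>z. eval_rat_poly f (\<lambda>(i, c). q z i c) | f.
    \<forall>m\<in>Poly_Mapping.keys f. Poly_Mapping.keys m \<subseteq> I}"
  have "germ_ring G z0 F0"
    unfolding F0_def using assms(2)
    by (intro germ_ring_rat_polys) (auto simp: generic_framework_def I_def lim)
  then obtain F where "germ_ring G z0 F" and F0: "F0 \<subseteq> F"
    and ex: "\<And>y. y \<in> \<omega> ` E \<Longrightarrow> \<exists>g\<in>F. g z0 = y"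
    using germ_ring_adjoin_finite[of G z0 F0 "\<omega> ` E"] by auto
  interpret germ_ring G z0 F by fact
  have coord: "(\<lambda>z. q z i c) \<in> F" if "c < d" for i c
  proof -
    have "(\<lambda>z. q z i c) \<in> F0" unfolding F0_def
      using that by (intro CollectI exI[of _ "Poly_Mapping.single (Poly_Mapping.single (i, c) 1) 1"])
        (auto simp: eval_rat_poly_single I_def)
    with F0 show ?thesis by blast
  qed
  have "\<forall>e\<in>E. \<exists>g. g \<in> F \<and> g z0 = \<omega> e" using ex by blast
  then obtain W0 where W0: "\<And>e. e \<in> E \<Longrightarrow> W0 e \<in> F" "\<And>e. e \<in> E \<Longrightarrow> W0 e z0 = \<omega> e"
    using bchoice[of E "\<lambda>e g. g \<in> F \<and> g z0 = \<omega> e"] by blast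
  \<comment> \<open>Zero off the edges, so that every \<open>W z e\<close> belongs to the ring as a
    function of \<open>z\<close>.\<close>
  define W where "W z e = (if e \<in> E then W0 e z else 0)" for z e
  have W_F: "(\<lambda>z. W z e) \<in> F" for e
    by (cases "e \<in> E") (simp_all add: W_def W0 zero)
  have Wz0: "W z0 e = \<omega> e" if "e \<in> E" for e using that by (simp add: W_def W0)
  have mat: "stress_matrix E (W z0) = stress_matrix E \<omega>"
    by (auto simp: stress_matrix_def vec_eq_iff neighbours_def Wz0 intro!: sum.cong)
  have "eventually (\<lambda>z. (\<Sum>j\<in>neighbours E i. W z {i, j} * (q z j c - q z i c)) = 0) G"
    if "c < d" for i c
  proof (rule eventually_zero)
    show "(\<lambda>z. \<Sum>j\<in>neighbours E i. W z {i, j} * (q z j c - q z i c)) \<in> F"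
      using that by (intro sum mult diff W_F coord)
    show "(\<Sum>j\<in>neighbours E i. W z0 {i, j} * (q z0 j c - q z0 i c)) = 0"
      using \<omega>(1) that by (simp add: equilibrium_stress_def Wz0 neighbours_def)
  qed
  then have "eventually (\<lambda>z. \<forall>i\<in>UNIV. \<forall>c\<in>{..<d}.
      (\<Sum>j\<in>neighbours E i. W z {i, j} * (q z j c - q z i c)) = 0) G"
    by (intro eventually_ball_finite ballI) auto
  then have eq: "eventually (\<lambda>z. equilibrium_stress E d (q z) (W z)) G"
    by eventually_elim (auto simp: equilibrium_stress_def)
  obtain e where e: "e \<in> E" "\<omega> e \<noteq> 0" using \<omega>(2) by (auto simp: nonzero_stress_def)
  have "eventually (\<lambda>z. W z e \<noteq> 0) G"
    using e by (intro tendsto_imp_eventually_ne[OF tendsto[OF W_F]]) (simp add: Wz0)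
  then have nz: "eventually (\<lambda>z. nonzero_stress E (W z)) G"
    by eventually_elim (use e in \<open>auto simp: nonzero_stress_def\<close>)
  have sym: "transpose (stress_matrix E \<omega>') = stress_matrix E \<omega>'" for \<omega>'
    by (auto simp: stress_matrix_def transpose_def vec_eq_iff insert_commute)
  have "eventually (\<lambda>z. \<forall>x. 0 \<le> quad_form UNIV (\<lambda>i j. stress_matrix E (W z) $ i $ j) x) G"
  proof (rule eventually_quad_form_nonneg)
    show "(\<lambda>z. stress_matrix E (W z) $ i $ j) \<in> F" for i j
      by (cases "i = j"; cases "{i, j} \<in> E") (auto simp: stress_matrix_def intro!: sum minus W_F zero)
    show "stress_matrix E (W z) $ i $ j = stress_matrix E (W z) $ j $ i" for z i j
      by (auto simp: stress_matrix_def insert_commute)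
    show "0 \<le> quad_form UNIV (\<lambda>i j. stress_matrix E (W z0) $ i $ j) x" for x
      using \<omega>(3) psd_iff_quad_form[OF sym, of \<omega>] by (simp add: mat)
  qed simp
  then have psd: "eventually (\<lambda>z. positive_semidefinite (stress_matrix E (W z))) G"
    by eventually_elim (simp add: psd_iff_quad_form[OF sym])
  from eq nz psd show ?thesis
    by eventually_elim (auto simp: supports_psd_stress_def)
qed

section \<open>Almost all samples are generic\<close>

text \<open>Each ray from a point where \<open>h\<close> does not vanish meets the zero set of \<open>h\<close> in finitely many
  points, so by Fubini almost every dilate of the zero set about that point is null.\<close>

lemma AE_lborel_nonzero_if_polynomial_on_lines:
  fixes h :: "'a::euclidean_space \<Rightarrow> real"
  assumes [measurable]: "h \<in> borel_measurable borel"
    and line: "\<And>x y. \<exists>p. \<forall>t. h (x + t *\<^sub>R y) = poly p t"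
    and "h x0 \<noteq> 0"
  shows "AE x in lborel. h x \<noteq> 0"
proof -
  have "AE t in lborel. h (x0 + t *\<^sub>R v) \<noteq> 0" for v
  proof -
    obtain p where p: "\<And>t. h (x0 + t *\<^sub>R v) = poly p t" using line by metis
    with \<open>h x0 \<noteq> 0\<close> have "p \<noteq> 0" by (metis poly_0 add.right_neutral scaleR_zero_left)
    then have "{t. poly p t = 0} \<in> null_sets lborel"
      by (intro finite_imp_null_set_lborel poly_roots_finite)
    from AE_not_in[OF this] show ?thesis by (simp add: p)
  qed
  then have "AE v in lborel. AE t in lborel. h (x0 + t *\<^sub>R v) \<noteq> 0" by simp
  moreover have "{z \<in> space (lborel \<Otimes>\<^sub>M lborel). h (x0 + fst z *\<^sub>R snd z) \<noteq> 0}
      \<in> sets (lborel \<Otimes>\<^sub>M (lborel :: 'a measure))"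
    by measurable
  ultimately have "AE t in lborel. AE v in lborel. h (x0 + t *\<^sub>R v) \<noteq> 0"
    by (subst lborel_pair.AE_commute)
  moreover have "AE t in lborel. t \<noteq> (0 :: real)"
    by (rule AE_lborel_singleton)
  ultimately have ae: "AE t in lborel. t \<noteq> (0 :: real) \<and> (AE v in lborel. h (x0 + t *\<^sub>R v) \<noteq> 0)"
    by eventually_elim simp
  have "\<exists>t :: real. t \<noteq> 0 \<and> (AE v in lborel. h (x0 + t *\<^sub>R v) \<noteq> 0)"
  proof (rule ccontr)
    assume "\<not> ?thesis"
    with ae have "AE t :: real in lborel. False" by (auto elim: eventually_mono)
    then have "UNIV \<in> null_sets (lborel :: real measure)" by (subst (asm) AE_iff_null) auto
    then show False by (simp add: null_sets_def)
  qed
  \<comment> \<open>A single non-zero scale is enough, since the affine map with this scale carries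
    Lebesgue measure to a constant multiple of itself.\<close>
  then obtain t where t: "t \<noteq> 0" "AE v in lborel. h (x0 + t *\<^sub>R v) \<noteq> 0" by blast
  show ?thesis
    by (subst lborel_affine[OF t(1), of x0]) (simp add: AE_density AE_distr_iff t(2))
qed

text \<open>Fubini, one sample at a time: for almost every value of the last sample,
  \<open>h\<close> remains non-zero somewhere as a function of the others, and the induction
  hypothesis applies to this section.\<close>

lemma AE_PiM_nonzero_if_polynomial_on_lines:
  fixes h :: "(nat \<Rightarrow> 'a::euclidean_space) \<Rightarrow> real"
  assumes M: "prob_space M" "sets M = sets lborel" "absolutely_continuous lborel M"
    and "h \<in> borel_measurable (PiM {..<N} (\<lambda>_. M))"
    and "\<And>X Y. \<exists>p. \<forall>t. h (\<lambda>k. X k + t *\<^sub>R Y k) = poly p t"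
    and "\<And>X Y. (\<And>k. k < N \<Longrightarrow> X k = Y k) \<Longrightarrow> h X = h Y"
    and "h X0 \<noteq> 0"
  shows "AE X in PiM {..<N} (\<lambda>_. M). h X \<noteq> 0"
  using assms(4-7)
proof (induction N arbitrary: h)
  case 0
  then show ?case by (intro AE_I2) (metis not_less0)
next
  case (Suc N)
  note meas[measurable] = Suc.prems(1)
  have spaceM [simp]: "space M = UNIV" using sets_eq_imp_space_eq[OF M(2)] by simp
  interpret M: prob_space M by fact
  interpret P: prob_space "PiM {..<N} (\<lambda>_. M)" by (intro prob_space_PiM M)
  interpret pair_sigma_finite M "PiM {..<N} (\<lambda>_. M)" ..
  have upd [measurable]: "(\<lambda>(x, X). X(N := x)) \<in> measurable (M \<Otimes>\<^sub>M PiM {..<N} (\<lambda>_. M)) (PiM {..<Suc N} (\<lambda>_. M))"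
    unfolding split_beta by (rule measurable_fun_upd[where J = "{..<N}"]) auto
  have upd2: "(\<lambda>X. X(N := x)) \<in> measurable (PiM {..<N} (\<lambda>_. M)) (PiM {..<Suc N} (\<lambda>_. M))" for x
    by (rule measurable_fun_upd[where J = "{..<N}"]) auto
  have eq: "PiM {..<Suc N} (\<lambda>_. M) = distr (M \<Otimes>\<^sub>M PiM {..<N} (\<lambda>_. M)) (PiM {..<Suc N} (\<lambda>_. M)) (\<lambda>(x, X). X(N := x))"
    using distr_pair_PiM_eq_PiM[of "{..<N}" "\<lambda>_. M" N] M(1) by (simp add: lessThan_Suc)
  have line_upd: "\<exists>p. \<forall>t. h (X(N := x + t *\<^sub>R y)) = poly p t" for X x y
  proof -
    have "X(N := x + t *\<^sub>R y) = (\<lambda>k. (X(N := x)) k + t *\<^sub>R ((\<lambda>_. 0)(N := y)) k)" for t by auto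
    then show ?thesis using Suc.prems(2)[of "X(N := x)" "(\<lambda>_. 0)(N := y)"] by simp
  qed
  have "AE x in M. AE X in PiM {..<N} (\<lambda>_. M). h (X(N := x)) \<noteq> 0"
  proof -
    \<comment> \<open>Elements of the product space are undefined outside the index set, so the
      witness is restricted before it serves to prove measurability of the section.\<close>
    define X1 where "X1 = (\<lambda>k\<in>{..<N}. X0 k)"
    have hX1: "h (X1(N := x)) = h (X0(N := x))" for x
      by (rule Suc.prems(3)) (auto simp: X1_def)
    have X1: "(\<lambda>x. X1(N := x)) \<in> measurable M (PiM {..<Suc N} (\<lambda>_. M))"
      by (rule measurable_fun_upd[where J = "{..<N}"]) (auto simp: X1_def space_PiM)
    have "AE x in lborel. h (X1(N := x)) \<noteq> 0"
    proof (rule AE_lborel_nonzero_if_polynomial_on_lines)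
      have "(\<lambda>x. h (X1(N := x))) \<in> borel_measurable M"
        using measurable_compose[OF X1 meas] .
      then show "(\<lambda>x. h (X1(N := x))) \<in> borel_measurable borel"
        using M(2) by (simp cong: measurable_cong_sets)
      show "\<exists>p. \<forall>t. h (X1(N := x + t *\<^sub>R y)) = poly p t" for x y by (rule line_upd)
      show "h (X1(N := X0 N)) \<noteq> 0" using Suc.prems(4) by (simp add: hX1)
    qed
    then have "AE x in M. h (X1(N := x)) \<noteq> 0"
      using absolutely_continuous_AE[OF _ M(3)] M(2) by simp
    then show ?thesis
    proof eventually_elim
      case (elim x)
      show ?case
      proof (rule Suc.IH)
        show "(\<lambda>X. h (X(N := x))) \<in> borel_measurable (PiM {..<N} (\<lambda>_. M))"
          using measurable_compose[OF upd2 meas] .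
        show "\<exists>p. \<forall>t. h ((\<lambda>k. X k + t *\<^sub>R Y k)(N := x)) = poly p t" for X Y
        proof -
          have "(\<lambda>k. X k + t *\<^sub>R Y k)(N := x) = (\<lambda>k. (X(N := x)) k + t *\<^sub>R (Y(N := 0)) k)" for t by auto
          then show ?thesis using Suc.prems(2)[of "X(N := x)" "Y(N := 0)"] by simp
        qed
        show "h (X(N := x)) = h (Y(N := x))" if "\<And>k. k < N \<Longrightarrow> X k = Y k" for X Y
          by (rule Suc.prems(3)) (use that in auto)
        show "h (X0(N := x)) \<noteq> 0" using elim by (simp add: hX1)
      qed
    qed
  qed
  then have "AE z in M \<Otimes>\<^sub>M PiM {..<N} (\<lambda>_. M). h (case z of (x, X) \<Rightarrow> X(N := x)) \<noteq> 0"
    by (intro AE_pair_measure) simp_all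
  then show ?case
    by (subst eq, subst AE_distr_iff) simp_all
qed

text \<open>Distinct monomials are distinct characters of the multiplicative monoid of assignments,
  hence linearly independent (Dedekind).\<close>

lemma monomials_independent:
  fixes c :: "('i \<Rightarrow>\<^sub>0 nat) \<Rightarrow> real"
  assumes "finite S" "\<And>x. (\<Sum>m\<in>S. c m * monomial_value m x) = 0" "m \<in> S"
  shows "c m = 0"
  using assms
proof (induction S arbitrary: c m rule: finite_induct)
  case (insert a S)
  have zero: "c m = 0" if "m \<in> S" for m
  proof -
    have "m \<noteq> a" using that insert.hyps by auto
    then obtain i where i: "Poly_Mapping.lookup m i \<noteq> Poly_Mapping.lookup a i"
      by (metis poly_mapping_eqI)
    \<comment> \<open>Doubling a variable whose exponents in \<open>m\<close> and \<open>a\<close>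
      differ separates the two characters.\<close>
    define y :: "'i \<Rightarrow> real" where "y = (\<lambda>_. 1)(i := 2)"
    have y: "monomial_value n y = 2 ^ Poly_Mapping.lookup n i" for n
      by (subst monomial_value_superset[of "insert i (Poly_Mapping.keys n)"])
        (auto simp: y_def prod.insert_remove intro!: prod.neutral)
    have "(\<Sum>m\<in>S. (c m * (monomial_value m y - monomial_value a y)) * monomial_value m x) = 0" for x
    proof -
      \<comment> \<open>The relation at the product of \<open>x\<close> and \<open>y\<close>, minus
        the value of \<open>a\<close> at \<open>y\<close> times the relation at \<open>x\<close>, no
        longer involves \<open>a\<close>.\<close>
      have "(\<Sum>m\<in>insert a S. c m * monomial_value m (\<lambda>i. x i * y i))
          - monomial_value a y * (\<Sum>m\<in>insert a S. c m * monomial_value m x) = 0"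
        by (simp only: insert.prems(1))
      then show ?thesis
        using insert.hyps
        by (simp add: prod.distrib power_mult_distrib algebra_simps sum_distrib_left sum_subtractf)
    qed
    from insert.IH[OF this that] show ?thesis using i by (simp add: y)
  qed
  have "c a * monomial_value a (\<lambda>_. 1) = 0"
    using insert.prems(1)[of "\<lambda>_. 1"] insert.hyps zero by simp
  then have "c a = 0" by simp
  with zero insert.prems(2) show ?case by auto
qed simp

lemma eval_rat_poly_nonzero_point:
  assumes "f \<noteq> 0"
  obtains x where "eval_rat_poly f x \<noteq> 0"
proof -
  have "\<exists>x. eval_rat_poly f x \<noteq> 0"
  proof (rule ccontr)
    assume "\<not> ?thesis"
    then have "real_of_rat (Poly_Mapping.lookup f m) = 0" if "m \<in> Poly_Mapping.keys f" for m
      using that monomials_independent[of "Poly_Mapping.keys f" "\<lambda>m. of_rat (Poly_Mapping.lookup f m)"]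
      by (simp add: eval_rat_poly_def)
    then have "Poly_Mapping.lookup f m = 0" for m by (auto simp: in_keys_iff)
    then have "f = 0" by (intro poly_mapping_eqI) simp
    with assms show False by simp
  qed
  with that show ?thesis by blast
qed

lemma eval_rat_poly_on_line: "\<exists>p. \<forall>t. eval_rat_poly f (\<lambda>i. a i + t * b i) = poly p t"
  unfolding eval_rat_poly_def
  by (rule exI[of _ "\<Sum>m\<in>Poly_Mapping.keys f. [:of_rat (Poly_Mapping.lookup f m):] *
      (\<Prod>i\<in>Poly_Mapping.keys m. [:a i, b i:] ^ Poly_Mapping.lookup m i)"])
    (simp add: poly_sum poly_prod)

lemma eval_rat_poly_cong:
  assumes "\<And>m. m \<in> Poly_Mapping.keys f \<Longrightarrow> Poly_Mapping.keys m \<subseteq> I" "\<And>i. i \<in> I \<Longrightarrow> x i = y i"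
  shows "eval_rat_poly f x = eval_rat_poly f y"
  unfolding eval_rat_poly_def
proof (rule sum.cong[OF refl])
  fix m assume "m \<in> Poly_Mapping.keys f"
  then have "x i = y i" if "i \<in> Poly_Mapping.keys m" for i using assms that by blast
  then show "of_rat (Poly_Mapping.lookup f m) * monomial_value m x
      = of_rat (Poly_Mapping.lookup f m) * monomial_value m y" by simp
qed

lemma borel_measurable_eval_rat_poly:
  assumes "\<And>m. m \<in> Poly_Mapping.keys f \<Longrightarrow> Poly_Mapping.keys m \<subseteq> I"
    and "\<And>i. i \<in> I \<Longrightarrow> (\<lambda>z. g z i) \<in> borel_measurable M"
  shows "(\<lambda>z. eval_rat_poly f (g z)) \<in> borel_measurable M"
  unfolding eval_rat_poly_def
  using assms by (intro borel_measurable_sum borel_measurable_times borel_measurable_prod borel_measurable_power) auto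

text \<open>A finitely supported map is encoded by its graph over the support, a finite subset of a
  countable set. Countability allows the exceptional null sets of all polynomials to be
  united.\<close>

lemma countable_UNIV_poly_mapping:
  assumes "countable (UNIV :: 'a set)" "countable (UNIV :: 'b::zero set)"
  shows "countable (UNIV :: ('a \<Rightarrow>\<^sub>0 'b) set)"
proof (rule countableI'[where f = "to_nat_on (Collect finite) \<circ> (\<lambda>f. (\<lambda>k. (k, Poly_Mapping.lookup f k)) ` Poly_Mapping.keys f)"])
  have "countable {A :: ('a \<times> 'b) set. finite A \<and> A \<subseteq> UNIV \<times> UNIV}"
    by (intro countable_Collect_finite_subset countable_SIGMA assms)
  then have "countable (Collect finite :: ('a \<times> 'b) set set)" by simp
  moreover have "inj (\<lambda>f :: 'a \<Rightarrow>\<^sub>0 'b. (\<lambda>k. (k, Poly_Mapping.lookup f k)) ` Poly_Mapping.keys f)"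
  proof (rule injI)
    fix f g :: "'a \<Rightarrow>\<^sub>0 'b"
    assume eq: "(\<lambda>k. (k, Poly_Mapping.lookup f k)) ` Poly_Mapping.keys f =
      (\<lambda>k. (k, Poly_Mapping.lookup g k)) ` Poly_Mapping.keys g"
    show "f = g"
    proof (rule poly_mapping_eqI)
      fix k
      have "Poly_Mapping.lookup f k = v \<longleftrightarrow> Poly_Mapping.lookup g k = v" if "v \<noteq> 0" for v
        using eq that by (auto simp: set_eq_iff image_iff in_keys_iff)
      then show "Poly_Mapping.lookup f k = Poly_Mapping.lookup g k" by metis
    qed
  qed
  ultimately show "inj (to_nat_on (Collect finite) \<circ> (\<lambda>f :: 'a \<Rightarrow>\<^sub>0 'b. (\<lambda>k. (k, Poly_Mapping.lookup f k)) ` Poly_Mapping.keys f))"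
    by (intro comp_inj_on) (auto intro: inj_on_subset[OF inj_on_to_nat_on])
qed

lemma generic_framework_cong:
  assumes "\<And>i c. c < d \<Longrightarrow> p i c = q i c" "generic_framework d p"
  shows "generic_framework d q"
  unfolding generic_framework_def algebraically_independent_def
proof (intro allI impI)
  fix f :: "(('a \<times> nat \<Rightarrow>\<^sub>0 nat) \<Rightarrow>\<^sub>0 rat)"
  assume f: "(\<forall>m\<in>Poly_Mapping.keys f. Poly_Mapping.keys m \<subseteq> UNIV \<times> {..<d}) \<and>
    eval_rat_poly f (\<lambda>(i, c). q i c) = 0"
  moreover have "eval_rat_poly f (\<lambda>(i, c). p i c) = eval_rat_poly f (\<lambda>(i, c). q i c)"
    using f assms(1) by (intro eval_rat_poly_cong[where I = "UNIV \<times> {..<d}"]) auto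
  ultimately show "f = 0"
    using assms(2) unfolding generic_framework_def algebraically_independent_def by metis
qed

text \<open>The quotients are not polynomial in the last sample. It is therefore fixed first, with
  non-zero coordinates, after which the expression is polynomial in the remaining samples.\<close>

lemma AE_eval_dehomogenized_nonzero:
  fixes M :: "(real ^ 'n::finite) measure" and d :: nat
  assumes "mutually_abs_cont_prob M" "f \<noteq> 0"
    and f: "\<And>m. m \<in> Poly_Mapping.keys f \<Longrightarrow> Poly_Mapping.keys m \<subseteq> UNIV \<times> {..<d}"
  shows "AE X in PiM {..<d + 1} (\<lambda>_. M). (\<forall>i. X d $ i \<noteq> 0) \<and>
    eval_rat_poly f (\<lambda>(i, c). X c $ i / X d $ i) \<noteq> 0"
proof -
  have M: "prob_space M" "sets M = sets borel" "absolutely_continuous lborel M"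
    using assms(1) by (auto simp: mutually_abs_cont_prob_def)
  have comp: "(\<lambda>x :: real ^ 'n. x $ i) \<in> borel_measurable M" for i
    using M(2) by (simp cong: measurable_cong_sets)
  note M(2)[measurable_cong]
  interpret M: prob_space M by fact
  interpret P: prob_space "PiM {..<d} (\<lambda>_. M)" by (intro prob_space_PiM M)
  interpret pair_sigma_finite M "PiM {..<d} (\<lambda>_. M)" ..
  let ?Q = "\<lambda>x X. (\<forall>i. x $ i \<noteq> 0) \<and> eval_rat_poly f (\<lambda>(i, c). X c $ i / x $ i) \<noteq> 0"
  have upd [measurable]: "(\<lambda>(x, X). X(d := x)) \<in>
      measurable (M \<Otimes>\<^sub>M PiM {..<d} (\<lambda>_. M)) (PiM {..<d + 1} (\<lambda>_. M))"
    unfolding split_beta by (rule measurable_fun_upd[where J = "{..<d}"]) auto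
  have eq: "PiM {..<d + 1} (\<lambda>_. M) =
      distr (M \<Otimes>\<^sub>M PiM {..<d} (\<lambda>_. M)) (PiM {..<d + 1} (\<lambda>_. M)) (\<lambda>(x, X). X(d := x))"
    using distr_pair_PiM_eq_PiM[of "{..<d}" "\<lambda>_. M" d] M(1) by (simp add: lessThan_Suc)
  have coord: "(\<lambda>X. X c $ i) \<in> borel_measurable (PiM J (\<lambda>_. M))" if "c \<in> J" for c i and J :: "nat set"
    using measurable_compose[OF measurable_component_singleton[OF that] comp] .
  have meas1: "(\<lambda>X. eval_rat_poly f (\<lambda>(i, c). X c $ i / X d $ i)) \<in> borel_measurable (PiM {..<d + 1} (\<lambda>_. M))"
    using f by (rule borel_measurable_eval_rat_poly) (auto intro!: borel_measurable_divide coord)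
  have nz: "AE x in M. \<forall>i. x $ i \<noteq> 0"
  proof -
    have "AE x in M. x $ i \<noteq> 0" for i
    proof -
      have "AE x :: real ^ 'n in lborel. x $ i \<noteq> 0"
      proof (rule AE_lborel_nonzero_if_polynomial_on_lines)
        show "\<exists>p. \<forall>t. (x + t *\<^sub>R y) $ i = poly p t" for x y :: "real ^ 'n"
          by (rule exI[of _ "[:x $ i, y $ i:]"]) simp
        show "axis i 1 $ i \<noteq> (0 :: real)" by simp
      qed simp
      then show ?thesis using absolutely_continuous_AE[OF _ M(3)] M(2) by simp
    qed
    then show ?thesis by (simp add: AE_all_countable)
  qed
  obtain q where q: "eval_rat_poly f q \<noteq> 0" using eval_rat_poly_nonzero_point[OF assms(2)] .
  have "AE x in M. AE X in PiM {..<d} (\<lambda>_. M). ?Q x X"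
    using nz
  proof eventually_elim
    case (elim x)
    have "AE X in PiM {..<d} (\<lambda>_. M). eval_rat_poly f (\<lambda>(i, c). X c $ i / x $ i) \<noteq> 0"
    proof (rule AE_PiM_nonzero_if_polynomial_on_lines)
      show "(\<lambda>X. eval_rat_poly f (\<lambda>(i, c). X c $ i / x $ i)) \<in> borel_measurable (PiM {..<d} (\<lambda>_. M))"
        using f by (rule borel_measurable_eval_rat_poly) (auto intro!: borel_measurable_divide coord)
      show "\<exists>p. \<forall>t. eval_rat_poly f (\<lambda>(i, c). (X c + t *\<^sub>R Y c) $ i / x $ i) = poly p t" for X Y :: "nat \<Rightarrow> real ^ 'n"
        using eval_rat_poly_on_line[of f "\<lambda>(i, c). X c $ i / x $ i" "\<lambda>(i, c). Y c $ i / x $ i"]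
        by (simp add: case_prod_unfold add_divide_distrib)
      show "eval_rat_poly f (\<lambda>(i, c). X c $ i / x $ i) = eval_rat_poly f (\<lambda>(i, c). Y c $ i / x $ i)"
        if "\<And>k. k < d \<Longrightarrow> X k = Y k" for X Y :: "nat \<Rightarrow> real ^ 'n"
        using that by (intro eval_rat_poly_cong[OF f]) auto
      \<comment> \<open>Multiplying the witness \<open>q\<close> by the coordinates of
        \<open>x\<close> compensates the division.\<close>
      show "eval_rat_poly f (\<lambda>(i, c). (\<chi> i. q (i, c) * x $ i) $ i / x $ i) \<noteq> 0"
        using q elim by simp
    qed (use M in auto)
    with elim show ?case by simp
  qed
  moreover have "eval_rat_poly f (\<lambda>(i, c). (X(d := x)) c $ i / x $ i) =
      eval_rat_poly f (\<lambda>(i, c). X c $ i / x $ i)" for x :: "real ^ 'n" and X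
    by (rule eval_rat_poly_cong[OF f]) auto
  ultimately have ae: "AE x in M. AE X in PiM {..<d} (\<lambda>_. M). ?Q x (X(d := x))" by simp
  define R where "R X \<longleftrightarrow> ?Q (X d) X" for X
  have meas2: "{X \<in> space (PiM {..<d + 1} (\<lambda>_. M)). R X} \<in> sets (PiM {..<d + 1} (\<lambda>_. M))"
    unfolding R_def using meas1 coord[of d "{..<d + 1}"] by measurable
  have "{z \<in> space (M \<Otimes>\<^sub>M PiM {..<d} (\<lambda>_. M)). R (case z of (x, X) \<Rightarrow> X(d := x))} =
      (\<lambda>(x, X). X(d := x)) -` {X \<in> space (PiM {..<d + 1} (\<lambda>_. M)). R X}
        \<inter> space (M \<Otimes>\<^sub>M PiM {..<d} (\<lambda>_. M))"
    using measurable_space[OF upd] by auto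
  then have "{z \<in> space (M \<Otimes>\<^sub>M PiM {..<d} (\<lambda>_. M)). R (case z of (x, X) \<Rightarrow> X(d := x))}
      \<in> sets (M \<Otimes>\<^sub>M PiM {..<d} (\<lambda>_. M))"
    using measurable_sets[OF upd meas2] by (simp only:)
  moreover have "AE x in M. AE X in PiM {..<d} (\<lambda>_. M). R (case (x, X) of (x, X) \<Rightarrow> X(d := x))"
    using ae by (simp add: R_def)
  ultimately have "AE z in M \<Otimes>\<^sub>M PiM {..<d} (\<lambda>_. M). R (case z of (x, X) \<Rightarrow> X(d := x))"
    by (rule AE_pair_measure)
  then have "AE X in PiM {..<d + 1} (\<lambda>_. M). R X"
    by (subst eq, subst AE_distr_iff[OF upd meas2])
  then show ?thesis by (simp only: R_def)
qed

lemma AE_generic_dehomogenized: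
  fixes M :: "(real ^ 'n::finite) measure" and d :: nat
  assumes "mutually_abs_cont_prob M"
  shows "AE X in PiM {..<d + 1} (\<lambda>_. M). (\<forall>i. X d $ i \<noteq> 0) \<and>
    generic_framework d (\<lambda>i c. X c $ i / X d $ i)"
proof -
  define FS where "FS = {f :: ('n \<times> nat \<Rightarrow>\<^sub>0 nat) \<Rightarrow>\<^sub>0 rat. f \<noteq> 0 \<and>
    (\<forall>m\<in>Poly_Mapping.keys f. Poly_Mapping.keys m \<subseteq> UNIV \<times> {..<d})}"
  have "countable (UNIV :: (('n \<times> nat \<Rightarrow>\<^sub>0 nat) \<Rightarrow>\<^sub>0 rat) set)"
    by (intro countable_UNIV_poly_mapping countableI_type)
  then have "countable FS" by (rule countable_subset[rotated]) simp
  have "AE X in PiM {..<d + 1} (\<lambda>_. M). \<forall>f\<in>FS. (\<forall>i. X d $ i \<noteq> 0) \<and>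
    eval_rat_poly f (\<lambda>(i, c). X c $ i / X d $ i) \<noteq> 0"
    unfolding AE_ball_countable[OF \<open>countable FS\<close>]
    using AE_eval_dehomogenized_nonzero[OF assms] by (auto simp: FS_def)
  then show ?thesis
  proof eventually_elim
    case (elim X)
    \<comment> \<open>The constant polynomial ensures that \<open>FS\<close> is non-empty, so the
      non-vanishing of \<open>X d\<close> can be read off.\<close>
    have "Poly_Mapping.single 0 1 \<in> FS" by (simp add: FS_def)
    with elim show ?case
      by (fastforce simp: generic_framework_def algebraically_independent_def FS_def)
  qed
qed

text \<open>The threshold quantifies over all such measures; a contradiction with almost sure
  existence requires that there is one. Any positive integrable density, normalized, will
  do.\<close>

lemma exists_mutually_abs_cont_prob:
  obtains M :: "(real ^ 'n::finite) measure" where "mutually_abs_cont_prob M"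
proof -
  obtain f :: "real ^ 'n \<Rightarrow> real" where f [measurable]: "f \<in> borel_measurable lborel"
    and pos: "\<And>x. f x > 0" and int: "integrable lborel f"
    using sigma_finite_measure.obtain_positive_integrable_function[OF sigma_finite_lborel] by metis
  define c where "c = integral\<^sup>L lborel f"
  have "c \<noteq> 0"
  proof
    assume "c = 0"
    then have "AE x in lborel. f x = 0"
      unfolding c_def using int pos by (subst (asm) integral_nonneg_eq_0_iff_AE) (auto intro: less_imp_le)
    then have "AE x :: real ^ 'n in lborel. False" by eventually_elim (use pos in \<open>metis less_irrefl\<close>)
    then have "UNIV \<in> null_sets (lborel :: (real ^ 'n) measure)" by (subst (asm) AE_iff_null) auto
    then show False by (simp add: null_sets_def)
  qed
  moreover have "c \<ge> 0" unfolding c_def using pos by (intro integral_nonneg_AE) (auto intro: less_imp_le)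
  ultimately have "c > 0" by simp
  define M where "M = density lborel (\<lambda>x. ennreal (f x / c))"
  have "emeasure M (space M) = (\<integral>\<^sup>+ x. ennreal (f x / c) \<partial>lborel)"
    by (simp add: M_def emeasure_density)
  also have "\<dots> = ennreal (integral\<^sup>L lborel (\<lambda>x. f x / c))"
    using int \<open>c > 0\<close> by (intro nn_integral_eq_integral) (simp_all add: less_imp_le[OF pos])
  also have "\<dots> = 1" using \<open>c > 0\<close> by (simp add: c_def)
  finally have "prob_space M" by (rule prob_spaceI)
  moreover have "absolutely_continuous M lborel"
    unfolding absolutely_continuous_def
  proof
    fix A assume "A \<in> null_sets M"
    then have A: "A \<in> sets lborel" "AE x in lborel. x \<in> A \<longrightarrow> ennreal (f x / c) = 0"
      by (auto simp: M_def null_sets_density_iff)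
    from A(2) have "AE x in lborel. x \<notin> A"
      by eventually_elim (use divide_pos_pos[OF pos \<open>c > 0\<close>] in \<open>auto simp: ennreal_eq_0_iff simp flip: not_less\<close>)
    with A(1) show "A \<in> null_sets lborel" by (subst (asm) AE_iff_null_sets[symmetric]) auto
  qed
  moreover have "absolutely_continuous lborel M"
    unfolding M_def by (rule absolutely_continuousI_density) simp
  ultimately show ?thesis
    by (intro that[of M]) (simp add: mutually_abs_cont_prob_def M_def)
qed

section \<open>Maximum likelihood threshold\<close>

text \<open>Balls have positive Lebesgue measure, hence positive \<open>M\<close>-measure, and the
  product of these measures is that of the box.\<close>

lemma not_AE_not_in_box:
  fixes M :: "(real ^ 'n::finite) measure" and N :: nat
  assumes "mutually_abs_cont_prob M" "\<epsilon> > 0"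
    and box: "\<And>X. (\<And>k. k < N \<Longrightarrow> dist (X k) (X0 k) < \<epsilon>) \<Longrightarrow> \<not> P X"
  shows "\<not> (AE X in PiM {..<N} (\<lambda>_. M). P X)"
proof
  assume ae: "AE X in PiM {..<N} (\<lambda>_. M). P X"
  have M: "prob_space M" "sets M = sets borel" "absolutely_continuous M lborel"
    using assms(1) by (auto simp: mutually_abs_cont_prob_def)
  interpret prob_space M by fact
  interpret product_sigma_finite "\<lambda>_. M" ..
  let ?B = "PiE {..<N} (\<lambda>k. ball (X0 k) \<epsilon>)"
  have pos: "emeasure M (ball (X0 k) \<epsilon>) \<noteq> 0" for k
  proof
    assume "emeasure M (ball (X0 k) \<epsilon>) = 0"
    then have "ball (X0 k) \<epsilon> \<in> null_sets M" using M(2) by (auto simp: null_sets_def)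
    then have "ball (X0 k) \<epsilon> \<in> null_sets lborel" using M(3) by (auto simp: absolutely_continuous_def)
    then have "ball (X0 k) \<epsilon> = {}"
      by (metis negligible_iff_null_sets null_sets_completionI open_ball open_not_negligible)
    with \<open>\<epsilon> > 0\<close> show False by simp
  qed
  have "emeasure (PiM {..<N} (\<lambda>_. M)) ?B = (\<Prod>k<N. emeasure M (ball (X0 k) \<epsilon>))"
    using M(2) by (intro emeasure_PiM) auto
  then have "emeasure (PiM {..<N} (\<lambda>_. M)) ?B \<noteq> 0" using pos by simp
  moreover have "?B \<in> sets (PiM {..<N} (\<lambda>_. M))"
    using M(2) by (intro sets_PiM_I_finite) auto
  then have "?B \<in> null_sets (PiM {..<N} (\<lambda>_. M))"
  proof (subst AE_iff_null_sets)
    show "AE X in PiM {..<N} (\<lambda>_. M). X \<notin> ?B"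
      using ae by eventually_elim (use box in \<open>auto simp: PiE_iff dist_commute\<close>)
  qed
  ultimately show False by auto
qed

text \<open>Only the first \<open>N\<close> samples are constrained, all by the same radius, so an
  eventual property holds on a box of the shape required by
  \<open>not_AE_not_in_box\<close>.\<close>

definition uniform_nhds :: "nat \<Rightarrow> (nat \<Rightarrow> 'a::metric_space) \<Rightarrow> (nat \<Rightarrow> 'a) filter" where
  "uniform_nhds N X0 = (INF \<epsilon>\<in>{0<..}. principal {X. \<forall>k<N. dist (X k) (X0 k) < \<epsilon>})"

lemma eventually_uniform_nhds:
  "eventually P (uniform_nhds N X0) \<longleftrightarrow> (\<exists>\<epsilon>>0. \<forall>X. (\<forall>k<N. dist (X k) (X0 k) < \<epsilon>) \<longrightarrow> P X)"
proof -
  have "\<exists>x\<in>{0<..}. principal {X. \<forall>k<N. dist (X k) (X0 k) < x}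
      \<le> inf (principal {X. \<forall>k<N. dist (X k) (X0 k) < a}) (principal {X. \<forall>k<N. dist (X k) (X0 k) < b})"
    if "a \<in> {0<..}" "b \<in> {0<..}" for a b :: real
    using that by (intro bexI[of _ "min a b"]) auto
  then show ?thesis unfolding uniform_nhds_def
    by (subst eventually_INF_base) (auto simp: eventually_principal)
qed

lemma tendsto_uniform_nhds: "k < N \<Longrightarrow> ((\<lambda>X. X k) \<longlongrightarrow> X0 k) (uniform_nhds N X0)"
  unfolding tendsto_iff eventually_uniform_nhds by blast

lemma AE_mle_exists_iff:
  fixes E :: "'n::finite set set" and d :: nat
  assumes "simple_graph E"
  shows "(\<forall>M :: (real ^ 'n) measure. mutually_abs_cont_prob M \<longrightarrow>
      (AE X in PiM {..<d + 1} (\<lambda>_. M). mle_exists E (d + 1) X)) \<longleftrightarrow> no_generic_psd_stress E d"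
proof
  assume no: "no_generic_psd_stress E d"
  show "\<forall>M :: (real ^ 'n) measure. mutually_abs_cont_prob M \<longrightarrow>
      (AE X in PiM {..<d + 1} (\<lambda>_. M). mle_exists E (d + 1) X)"
  proof (intro allI impI)
    fix M :: "(real ^ 'n) measure" assume "mutually_abs_cont_prob M"
    from AE_generic_dehomogenized[OF this, of d]
    show "AE X in PiM {..<d + 1} (\<lambda>_. M). mle_exists E (d + 1) X"
    proof eventually_elim
      case (elim X)
      then have "\<not> supports_psd_stress E d (\<lambda>i c. X c $ i / X d $ i)"
        using no by (auto simp: no_generic_psd_stress_def)
      then show ?case
        using elim supports_psd_stress_dehomogenize[OF assms, of X d] mle_exists_iff[of "d + 1" E X]
        by simp
    qed
  qed
next
  assume ae: "\<forall>M :: (real ^ 'n) measure. mutually_abs_cont_prob M \<longrightarrow>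
      (AE X in PiM {..<d + 1} (\<lambda>_. M). mle_exists E (d + 1) X)"
  show "no_generic_psd_stress E d"
    unfolding no_generic_psd_stress_def
  proof (rule notI, elim exE conjE)
    fix p :: "'n \<Rightarrow> nat \<Rightarrow> real"
    assume p: "generic_framework d p" "supports_psd_stress E d p"
    \<comment> \<open>The framework is homogenized by a last sample constantly one, so dividing by
      that sample gives back \<open>p\<close>.\<close>
    define X0 :: "nat \<Rightarrow> real ^ 'n" where "X0 c = (\<chi> i. if c = d then 1 else p i c)" for c
    define q where "q X i c = X c $ i / X d $ i" for X :: "nat \<Rightarrow> real ^ 'n" and i c
    define G where "G = uniform_nhds (d + 1) X0"
    have q0: "q X0 i c = p i c" if "c < d" for i c using that by (simp add: q_def X0_def)
    have lim: "((\<lambda>X. X c $ i) \<longlongrightarrow> X0 c $ i) G" if "c \<le> d" for c i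
      unfolding G_def using that by (intro tendsto_vec_nth tendsto_uniform_nhds) simp
    have "generic_framework d (q X0)" by (rule generic_framework_cong[OF _ p(1)]) (simp add: q0)
    moreover have "supports_psd_stress E d (q X0)"
      using p(2) supports_psd_stress_cong[of d p "q X0" E] by (simp add: q0)
    moreover have "((\<lambda>X. q X i c) \<longlongrightarrow> q X0 i c) G" if "c < d" for i c
      unfolding q_def using that by (intro tendsto_divide lim) (simp_all add: X0_def)
    ultimately have "eventually (\<lambda>X. supports_psd_stress E d (q X)) G"
      using eventually_supports_psd_stress[OF assms, of d q X0 G] by blast
    moreover have "eventually (\<lambda>X. X d $ i \<noteq> 0) G" for i
      using lim[of d i] by (intro tendsto_imp_eventually_ne) (auto simp: X0_def)
    then have "eventually (\<lambda>X. \<forall>i. X d $ i \<noteq> 0) G" by (rule eventually_all_finite)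
    ultimately have "eventually (\<lambda>X. \<not> mle_exists E (d + 1) X) G"
    proof eventually_elim
      case (elim X)
      then have "annihilated_by_psd E (d + 1) X"
        using supports_psd_stress_dehomogenize[OF assms, of X d] by (simp add: q_def[abs_def])
      then show ?case by (rule mle_not_exists)
    qed
    then obtain \<epsilon> where "\<epsilon> > 0"
      "\<And>X. (\<And>k. k < d + 1 \<Longrightarrow> dist (X k) (X0 k) < \<epsilon>) \<Longrightarrow> \<not> mle_exists E (d + 1) X"
      unfolding G_def eventually_uniform_nhds by blast
    moreover obtain M :: "(real ^ 'n) measure" where M: "mutually_abs_cont_prob M"
      using exists_mutually_abs_cont_prob .
    ultimately have "\<not> (AE X in PiM {..<d + 1} (\<lambda>_. M). mle_exists E (d + 1) X)"
      by (intro not_AE_not_in_box[of M \<epsilon> "d + 1" X0]) auto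
    with ae M show False by blast
  qed
qed

lemma Inf_enat_eq_iff:
  "Inf {enat N |N. P N} = enat n \<longleftrightarrow> P n \<and> (\<forall>m<n. \<not> P m)"
proof
  assume eq: "Inf {enat N |N. P N} = enat n"
  have "{enat N |N. P N} \<noteq> {}"
  proof
    assume "{enat N |N. P N} = {}"
    with eq have "Inf {} = enat n" by simp
    then show False by (simp add: Inf_enat_def)
  qed
  then have "Inf {enat N |N. P N} \<in> {enat N |N. P N}"
    unfolding Inf_enat_def by (auto intro: LeastI)
  with eq have "P n" by auto
  moreover have "\<not> P m" if "m < n" for m
  proof
    assume "P m"
    then have "Inf {enat N |N. P N} \<le> enat m" by (intro Inf_lower) auto
    with eq that show False by simp
  qed
  ultimately show "P n \<and> (\<forall>m<n. \<not> P m)" by blast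
next
  assume "P n \<and> (\<forall>m<n. \<not> P m)"
  then show "Inf {enat N |N. P N} = enat n"
    by (intro antisym Inf_lower Inf_greatest) (auto simp: not_less[symmetric])
qed

theorem mainTheorem1:
  fixes E :: "'n::finite set set" and d :: nat
  assumes "simple_graph E"
  shows "mlt E = enat (d + 1) \<longleftrightarrow>
    no_generic_psd_stress E d \<and> (\<forall>d'<d. \<not> no_generic_psd_stress E d')"
proof -
  let ?P = "\<lambda>N. N \<ge> 1 \<and> (\<forall>M :: (real ^ 'n) measure. mutually_abs_cont_prob M \<longrightarrow>
    (AE X in PiM {..<N} (\<lambda>_. M). mle_exists E N X))"
  have P_Suc: "?P (k + 1) \<longleftrightarrow> no_generic_psd_stress E k" for k
    using AE_mle_exists_iff[OF assms, of k] by simp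
  \<comment> \<open>The value \<open>N = 0\<close> is excluded by \<open>N \<ge> 1\<close>, which
    accounts for the shift by one between sample sizes and dimensions.\<close>
  have "(\<forall>N<d + 1. \<not> ?P N) \<longleftrightarrow> (\<forall>k<d. \<not> ?P (k + 1))"
  proof (intro iffI allI impI)
    fix N assume *: "\<forall>k<d. \<not> ?P (k + 1)" and "N < d + 1"
    show "\<not> ?P N"
    proof (cases N)
      case (Suc k)
      then have N: "N = k + 1" by simp
      with \<open>N < d + 1\<close> have "k < d" by simp
      with * show ?thesis unfolding N by blast
    qed simp
  next
    fix k assume "\<forall>N<d + 1. \<not> ?P N" "k < d"
    then show "\<not> ?P (k + 1)" by (elim allE[of _ "k + 1"]) simp
  qed
  then show ?thesis
    unfolding mlt_def Inf_enat_eq_iff P_Suc by simp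
qed

end
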